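(* Up to a nonzero constant, $$\tilde\Delta(t,u):=\mathrm{Res}_{(s,v)}\Big(\frac{F(s,v;t,u)}{su-tv},\frac{G(s,v;t,u)}{su-tv}\Big)=c(t,u)^{n-1}\,d_n(t,u)^{n-1}d_{n-1}(t,u)^{n-2}\cdots d_2(t,u).$$
   Context: Let $a,b,c\in\mathbb C[s,v]$ be homogeneous of the same degree $n\ge3$, $\gcd(a,b,c)=1$, with $\phi=(a:b:c):\mathbb P^1\to\mathbb P^2$ birational onto its image. $F(s,v;t,u)=a(s,v)c(t,u)-a(t,u)c(s,v)$, $G(s,v;t,u)=b(s,v)c(t,u)-b(t,u)c(s,v)$; both are divisible by $su-tv$, and $\mathrm{Res}_{(s,v)}$ is the Sylvester resultant of two binary forms of degree $n-1$ in $(s,v)$. Singular factors: with $p,q$ a $\mu$-basis (homogeneous basis of degrees $\mu\le n-\mu$ of the free syzygy module of $(a,b,c)$), $p_\phi=\sum_ip_i(s,v)\phi_i(t,u)$, $q_\phi=\sum_iq_i(s,v)\phi_i(t,u)$, $(\phi_1,\phi_2,\phi_3)=(a,b,c)$, and $S_{p_\phi,q_\phi}(t,u)$ their $n\times n$ Sylvester matrix in $(s,v)$, the singular factors are homogeneous $d_1,\ldots,d_n\in\mathbb C[t,u]$ with $d_n^{n-i+1}\cdots d_{i+1}^2d_i$ equal (up to constant) to the gcd of the $(n+1-i)$-minors of $S_{p_\phi,q_\phi}(t,u)$. *)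

theory Defs
  imports "Subresultants.Resultant_Prelim" "Jordan_Normal_Form.DL_Submatrix"
    "HOL-Computational_Algebra.Polynomial_Factorial" "HOL-Computational_Algebra.Field_as_Ring"
begin

text \<open>Conventions.
  A binary form of degree n in (s,v) over C is encoded by a univariate polynomial
  a :: complex poly with degree a \<le> n, meaning a(s,v) = sum_{i\<le>n} coeff a i * s^i * v^(n-i).
  The bivariate polynomial ring C[x,y] is complex poly poly (outer variable x,
  inner variable y).  Forms in (s,v) with coefficients in C[t,u] are encoded as
  (complex poly poly) poly in the variable s (dehomogenised at v = 1), always
  together with an explicit formal degree.\<close>

definition X2 :: "complex poly poly" where "X2 = [:0, 1:]"
definition Y2 :: "complex poly poly" where "Y2 = [:[:0, 1:]:]"

definition const2 :: "complex \<Rightarrow> complex poly poly" where "const2 x = [:[:x:]:]"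

definition hom :: "nat \<Rightarrow> complex poly \<Rightarrow> complex poly poly" where
  "hom n a = (\<Sum>i\<le>n. const2 (coeff a i) * X2 ^ i * Y2 ^ (n - i))"

definition evf :: "nat \<Rightarrow> complex poly \<Rightarrow> complex \<Rightarrow> complex \<Rightarrow> complex" where
  "evf n a s v = (\<Sum>i\<le>n. coeff a i * s ^ i * v ^ (n - i))"

definition lift :: "complex poly \<Rightarrow> complex poly poly poly" where
  "lift a = map_poly const2 a"

definition homogeneous2 :: "complex poly poly \<Rightarrow> bool" where
  "homogeneous2 f \<longleftrightarrow> (\<exists>k. \<forall>i j. coeff (coeff f i) j \<noteq> 0 \<longrightarrow> i + j = k)"

text \<open>Linear dependence of two vectors in C^3 (same point of P^2 when both nonzero).\<close>
definition parallel3 :: "complex \<times> complex \<times> complex \<Rightarrow> complex \<times> complex \<times> complex \<Rightarrow> bool" where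
  "parallel3 p q = (case p of (x, y, z) \<Rightarrow> case q of (x', y', z') \<Rightarrow>
      x * y' = x' * y \<and> x * z' = x' * z \<and> y * z' = y' * z)"

text \<open>phi = (a:b:c) : P^1 -> P^2 is birational onto its image (proper parametrisation):
  it is injective outside finitely many parameters.  The affine chart v = 1 carries
  all but one point of P^1, so it suffices to require finiteness of the set of
  affine parameters x for which some other point (s:v) of P^1 has the same image.\<close>
definition birational_param :: "nat \<Rightarrow> complex poly \<Rightarrow> complex poly \<Rightarrow> complex poly \<Rightarrow> bool" where
  "birational_param n a b c \<longleftrightarrow>
     finite {x. \<exists>s v. (s, v) \<noteq> (0, 0) \<and> s \<noteq> x * v \<and>
        parallel3 (evf n a s v, evf n b s v, evf n c s v) (evf n a x 1, evf n b x 1, evf n c x 1)}"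

definition mu_basis ::
  "nat \<Rightarrow> complex poly \<Rightarrow> complex poly \<Rightarrow> complex poly \<Rightarrow> nat \<Rightarrow>
   complex poly \<times> complex poly \<times> complex poly \<Rightarrow> complex poly \<times> complex poly \<times> complex poly \<Rightarrow> bool" where
  "mu_basis n a b c \<mu> p q \<longleftrightarrow>
     (case p of (p1, p2, p3) \<Rightarrow> case q of (q1, q2, q3) \<Rightarrow>
       \<mu> \<le> n - \<mu> \<and>
       degree p1 \<le> \<mu> \<and> degree p2 \<le> \<mu> \<and> degree p3 \<le> \<mu> \<and>
       degree q1 \<le> n - \<mu> \<and> degree q2 \<le> n - \<mu> \<and> degree q3 \<le> n - \<mu> \<and>
       hom \<mu> p1 * hom n a + hom \<mu> p2 * hom n b + hom \<mu> p3 * hom n c = 0 \<and>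
       hom (n - \<mu>) q1 * hom n a + hom (n - \<mu>) q2 * hom n b + hom (n - \<mu>) q3 * hom n c = 0 \<and>
       (\<forall>h1 h2 h3. h1 * hom n a + h2 * hom n b + h3 * hom n c = 0 \<longrightarrow>
          (\<exists>f g. h1 = f * hom \<mu> p1 + g * hom (n - \<mu>) q1 \<and>
                 h2 = f * hom \<mu> p2 + g * hom (n - \<mu>) q2 \<and>
                 h3 = f * hom \<mu> p3 + g * hom (n - \<mu>) q3)) \<and>
       (\<forall>f g. f * hom \<mu> p1 + g * hom (n - \<mu>) q1 = 0 \<and>
              f * hom \<mu> p2 + g * hom (n - \<mu>) q2 = 0 \<and>
              f * hom \<mu> p3 + g * hom (n - \<mu>) q3 = 0 \<longrightarrow> f = 0 \<and> g = 0))"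

definition syz_phi :: "nat \<Rightarrow> complex poly \<Rightarrow> complex poly \<Rightarrow> complex poly \<Rightarrow>
   complex poly \<times> complex poly \<times> complex poly \<Rightarrow> complex poly poly poly" where
  "syz_phi n a b c p = (case p of (p1, p2, p3) \<Rightarrow>
      smult (hom n a) (lift p1) + smult (hom n b) (lift p2) + smult (hom n c) (lift p3))"

definition minors :: "nat \<Rightarrow> 'a :: comm_ring_1 mat \<Rightarrow> 'a set" where
  "minors k A = {det (submatrix A I J) | I J.
      I \<subseteq> {..<dim_row A} \<and> J \<subseteq> {..<dim_col A} \<and> card I = k \<and> card J = k}"

definition singular_factors ::
  "nat \<Rightarrow> complex poly \<Rightarrow> complex poly \<Rightarrow> complex poly \<Rightarrow> nat \<Rightarrow>
   complex poly \<times> complex poly \<times> complex poly \<Rightarrow> complex poly \<times> complex poly \<times> complex poly \<Rightarrow>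
   (nat \<Rightarrow> complex poly poly) \<Rightarrow> bool" where
  "singular_factors n a b c \<mu> p q d \<longleftrightarrow>
     (\<forall>i\<in>{1..n}. homogeneous2 (d i) \<and>
        (\<exists>k::complex. k \<noteq> 0 \<and>
          (\<Prod>j\<in>{i..n}. d j ^ (j - i + 1)) =
            const2 k * Gcd (minors (n + 1 - i)
              (sylvester_mat_sub \<mu> (n - \<mu>) (syz_phi n a b c p) (syz_phi n a b c q)))))"

end

theory Submission
  imports Defs "HOL-Computational_Algebra.Fundamental_Theorem_Algebra"
begin

text \<open>Write L = s u - t v, and P = p_phi = L P', Q = q_phi = L Q', F = L F', G = L G'.  Only the case
  i = 2 of the definition of the singular factors matters: the product on the right-hand side is
  the gcd of the (n-1)-minors of the Sylvester matrix S of P and Q.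

  The row of coefficients of (Q', -P') annihilates S from the left and the column of monomials
  in t, u annihilates it from the right.  Hence the cofactors of S are, up to sign, the products of
  Res(P', Q'), a coefficient of P' or Q', and a monomial of degree n-1.  The coefficients of P' and Q' have no
  common factor because phi is not constant, so the gcd of the minors is Res(P', Q').

  It remains to compare Res(F', G') with c^(n-1) Res(P', Q').  The cross product of p and q is a
  constant multiple of (a, b, c), which gives F' = p2 Q' - q2 P' and p2 G' + p1 F' = - c(s,v) P' up to constants.
  Evaluating Res(F', p2 G') in two ways by multiplicativity, and Res(F', c) from
  L F' = c(t,u) a(s,v) - a(t,u) c(s,v), yields the claim, provided that a and c are coprime so that the
  constants that are cancelled do not vanish.  Replacing a by a + x b for a
  generic number x achieves this and does not change the resultant of F' and G'.\<close>
section \<open>Sylvester matrices as coefficient matrices\<close>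

text \<open>The pair (F', G') arises from (P', Q') by a 2 x 2 matrix over C[s,v] whose determinant
  is a multiple of c(s,v), but resultants are not multiplicative in such a matrix. Triangularising
  it costs a factor p2: modulo F', p2 G' is -c(s,v) P'; modulo p2, F' is a multiple of q2 P'; modulo
  P', it is a multiple of p2 Q'. Then Res(P', p2) stands on both sides and cancels, while Res(q2,
  p2) and Res(a, c) are constants. The exponent n-1 has its origin in Res(L F', c), which yields
  c(t,u)^n, of which Res(L, c) takes one factor. Leading coefficients may vanish, so every resultant
  carries formal degrees: a vanishing formal leading coefficient is a root at infinity, and each
  condition on roots has a companion condition on leading coefficients. Row operations on Sylvester
  matrices are carried out as identities between the polynomials that the rows encode. If c = 0 or
  \<mu> = 0 the argument breaks down; there both sides are 0.\<close>

definition pmat :: "nat \<Rightarrow> (nat \<Rightarrow> 'a::zero poly) \<Rightarrow> 'a mat" where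
  "pmat N f = mat N N (\<lambda>(i, j). coeff (f i) (N - 1 - j))"

lemma pmat_carrier [simp]: "pmat N f \<in> carrier_mat N N"
  by (simp add: pmat_def)

lemma pmat_dim [simp]: "dim_row (pmat N f) = N" "dim_col (pmat N f) = N"
  by (simp_all add: pmat_def)

lemma pmat_index: "i < N \<Longrightarrow> j < N \<Longrightarrow> pmat N f $$ (i, j) = coeff (f i) (N - 1 - j)"
  by (simp add: pmat_def)

text \<open>Reading off coefficients is linear, so an identity between polynomials becomes a
  factorisation of matrices. Coefficients beyond \<open>N - 1\<close> are cut off on both sides
  alike.\<close>

lemma pmat_mult:
  fixes g h :: "nat \<Rightarrow> 'a::comm_ring_1 poly"
  assumes T: "T \<in> carrier_mat N N"
    and h: "\<And>i. i < N \<Longrightarrow> h i = (\<Sum>k<N. smult (T $$ (i, k)) (g k))"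
  shows "pmat N h = T * pmat N g"
proof (rule eq_matI)
  fix i j assume "i < dim_row (T * pmat N g)" "j < dim_col (T * pmat N g)"
  then have ij: "i < N" "j < N" using T by auto
  have "(T * pmat N g) $$ (i, j) = (\<Sum>k<N. T $$ (i, k) * coeff (g k) (N - 1 - j))"
    using ij T by (auto simp: scalar_prod_def pmat_index lessThan_atLeast0 intro!: sum.cong)
  then show "pmat N h $$ (i, j) = (T * pmat N g) $$ (i, j)"
    using ij by (simp add: pmat_index h coeff_sum)
qed (use T in auto)

lemma sum_lessThan_add:
  fixes F :: "nat \<Rightarrow> 'b::comm_monoid_add"
  shows "(\<Sum>k<n + m. F k) = (\<Sum>k<n. F k) + (\<Sum>k<m. F (n + k))"
  by (induction m) (simp_all add: add.assoc)

text \<open>The sum runs from the highest power down, the row order of a Sylvester matrix, so that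
  the coefficients of \<open>h\<close> form a row of a transformation matrix. The bound is put on
  coefficients, since \<open>K = 0\<close> has to force \<open>h = 0\<close>.\<close>

lemma mult_eq_sum_shifts:
  fixes h f :: "'a::comm_ring_1 poly"
  assumes "\<And>i. i \<ge> K \<Longrightarrow> coeff h i = 0"
  shows "h * f = (\<Sum>k<K. smult (coeff h (K - 1 - k)) (monom 1 (K - 1 - k) * f))"
proof -
  have "h = (\<Sum>k<K. monom (coeff h k) k)"
    by (rule poly_eqI) (use assms in \<open>simp add: coeff_sum not_less\<close>)
  also have "\<dots> = (\<Sum>k<K. monom (coeff h (K - 1 - k)) (K - 1 - k))"
    using sum.nat_diff_reindex[of "\<lambda>k. monom (coeff h k) k" K] by simp
  finally have "h * f = (\<Sum>k<K. monom (coeff h (K - 1 - k)) (K - 1 - k)) * f" by simp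
  also have "\<dots> = (\<Sum>k<K. smult (coeff h (K - 1 - k)) (monom 1 (K - 1 - k)) * f)"
    by (simp add: sum_distrib_right smult_monom)
  finally show ?thesis by simp
qed

definition sylvester_row :: "nat \<Rightarrow> nat \<Rightarrow> 'a::comm_semiring_1 poly \<Rightarrow> 'a poly \<Rightarrow> nat \<Rightarrow> 'a poly" where
  "sylvester_row m n f g i = (if i < n then monom 1 (n - 1 - i) * f else monom 1 (m + n - 1 - i) * g)"

lemma sylvester_mat_sub_eq_pmat:
  fixes f g :: "'a::comm_ring_1 poly"
  assumes f: "degree f \<le> m" and g: "degree g \<le> n"
  shows "sylvester_mat_sub m n f g = pmat (m + n) (sylvester_row m n f g)"
proof (rule eq_matI)
  fix i j assume "i < dim_row (pmat (m + n) (sylvester_row m n f g))"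
    "j < dim_col (pmat (m + n) (sylvester_row m n f g))"
  then have ij: "i < m + n" "j < m + n" by auto
  have f0: "coeff f k = 0" if "k > m" for k
    using f that by (simp add: coeff_eq_0)
  have g0: "coeff g k = 0" if "k > n" for k
    using g that by (simp add: coeff_eq_0)
  show "sylvester_mat_sub m n f g $$ (i, j) = pmat (m + n) (sylvester_row m n f g) $$ (i, j)"
    using ij
    by (auto simp: sylvester_mat_sub_index pmat_index sylvester_row_def coeff_monom_mult
        intro!: f0 g0 f0[symmetric] g0[symmetric] arg_cong[of _ _ "coeff f"] arg_cong[of _ _ "coeff g"])
qed auto

lemma resultant_sub_eq_pmat:
  fixes f g :: "'a::comm_ring_1 poly"
  assumes "degree f \<le> m" "degree g \<le> n"
  shows "resultant_sub m n f g = det (pmat (m + n) (sylvester_row m n f g))"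
  by (simp add: resultant_sub_def sylvester_mat_sub_eq_pmat assms)

lemma det_lower_triangular_prod:
  fixes A :: "'a::comm_ring_1 mat"
  assumes "A \<in> carrier_mat N N" "\<And>i j. i < j \<Longrightarrow> j < N \<Longrightarrow> A $$ (i, j) = 0"
  shows "det A = (\<Prod>i<N. A $$ (i, i))"
  using assms by (subst det_lower_triangular[of N]) (auto simp: prod_list_diag_prod lessThan_atLeast0)

lemma det_upper_triangular_prod:
  fixes A :: "'a::comm_ring_1 mat"
  assumes "A \<in> carrier_mat N N" "\<And>i j. j < i \<Longrightarrow> i < N \<Longrightarrow> A $$ (i, j) = 0"
  shows "det A = (\<Prod>i<N. A $$ (i, i))"
  using assms by (subst det_upper_triangular[of _ N]) (auto simp: prod_list_diag_prod lessThan_atLeast0)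

text \<open>Adding \<open>h * f\<close> to \<open>g\<close> adds combinations of
  \<open>f\<close>-rows to the \<open>g\<close>-rows, a unipotent transformation \<open>T\<close>.
  The bound on \<open>degree h\<close> keeps the required shifts of \<open>f\<close> among the
  \<open>n\<close> available ones.\<close>

lemma resultant_sub_add_mult_right:
  fixes f g h :: "'a::comm_ring_1 poly"
  assumes f: "degree f \<le> m" and g: "degree g \<le> n" and h: "degree h + m \<le> n"
  shows "resultant_sub m n f (g + h * f) = resultant_sub m n f g"
proof -
  define T where "T = mat (m + n) (m + n) (\<lambda>(i, k). 
     if n \<le> i \<and> k < n then coeff (monom 1 (m + n - 1 - i) * h) (n - 1 - k)
     else if i = k then 1 else (0::'a))"
  have T: "T \<in> carrier_mat (m + n) (m + n)" by (simp add: T_def)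
  have g': "degree (g + h * f) \<le> n"
    using degree_mult_le[of h f] f g h by (intro degree_add_le) auto
  have "pmat (m + n) (sylvester_row m n f (g + h * f)) = T * pmat (m + n) (sylvester_row m n f g)"
  proof (rule pmat_mult[OF T])
    fix i assume i: "i < m + n"
    define F where "F k = smult (T $$ (i, k)) (sylvester_row m n f g k)" for k
    have S: "(\<Sum>k<m + n. F k) = (\<Sum>k<n. F k) + (\<Sum>k<m. F (n + k))"
      using sum_lessThan_add[of F n m] by (simp add: add.commute)
    show "sylvester_row m n f (g + h * f) i = (\<Sum>k<m + n. smult (T $$ (i, k)) (sylvester_row m n f g k))"
    proof (cases "i < n")
      case True
      have "F k = (if k = i then sylvester_row m n f g i else 0)" if "k < m + n" for k
        using that i True by (simp add: F_def T_def)
      then have "(\<Sum>k<m + n. F k) = sylvester_row m n f g i"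
        using i by simp
      then show ?thesis using True by (simp add: F_def sylvester_row_def)
    next
      case False
      have deg: "coeff (monom 1 (m + n - 1 - i) * h) k = 0" if "k \<ge> n" for k
        using that h i False by (auto simp: coeff_monom_mult intro!: coeff_eq_0)
      have "(\<Sum>k<n. F k) = (\<Sum>k<n. smult (coeff (monom 1 (m + n - 1 - i) * h) (n - 1 - k)) (monom 1 (n - 1 - k) * f))"
        using i False by (intro sum.cong) (auto simp: F_def T_def sylvester_row_def)
      also have "\<dots> = (monom 1 (m + n - 1 - i) * h) * f"
        by (rule mult_eq_sum_shifts[symmetric]) (rule deg)
      finally have 1: "(\<Sum>k<n. F k) = monom 1 (m + n - 1 - i) * h * f" .
      have "F (n + k) = (if k = i - n then sylvester_row m n f g i else 0)" if "k < m" for k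
        using that i False by (auto simp: F_def T_def)
      then have 2: "(\<Sum>k<m. F (n + k)) = sylvester_row m n f g i"
        using i False by auto
      show ?thesis unfolding F_def[symmetric] S 1 2 using False
        by (simp add: sylvester_row_def algebra_simps)
    qed
  qed
  moreover have "det T = 1"
    by (subst det_lower_triangular_prod[OF T]) (auto simp: T_def intro!: prod.neutral)
  ultimately show ?thesis
    using f g g' by (simp add: resultant_sub_eq_pmat det_mult[OF T])
qed

lemma resultant_sub_swap:
  fixes f g :: "'a::comm_ring_1 poly"
  shows "resultant_sub m n f g = (-1) ^ (m * n) * resultant_sub n m g f"
proof -
  define A where "A = sylvester_mat_sub n m g f"
  have A: "A \<in> carrier_mat (m + n) (m + n)" by (auto simp: A_def)
  have "det A = (- 1) ^ (m * n) * det (mat (m + n) (m + n) (\<lambda>(i, j). A $$ (if i < n then i + m else i - n, j)))"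
    using det_swap_rows[of A n m] A by (simp add: ac_simps)
  also have "mat (m + n) (m + n) (\<lambda>(i, j). A $$ (if i < n then i + m else i - n, j)) = sylvester_mat_sub m n f g"
    by (rule eq_matI) (auto simp: A_def sylvester_mat_sub_def add.commute)
  finally show ?thesis by (simp add: resultant_sub_def A_def flip: power_mult_distrib mult.assoc)
qed

lemma resultant_sub_add_mult_left:
  fixes f g h :: "'a::comm_ring_1 poly"
  assumes "degree f \<le> m" "degree g \<le> n" "degree h + n \<le> m"
  shows "resultant_sub m n (f + h * g) g = resultant_sub m n f g"
  using resultant_sub_add_mult_right[of g n f m h] assms
  by (simp add: resultant_sub_swap[of m n])

lemma (in comm_ring_hom) hom_resultant_sub:
  "hom (resultant_sub m n f g) = resultant_sub m n (map_poly hom f) (map_poly hom g)"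
  by (simp add: resultant_sub_def flip: hom_det sylvester_mat_sub_map)

section \<open>Multiplicativity of resultants\<close>

lemma coeff_monom_mult_degree_less:
  fixes f :: "'a::comm_semiring_1 poly"
  assumes "degree f \<le> d" "e + d < k"
  shows "coeff (monom 1 e * f) k = 0"
  using assms by (auto simp: coeff_monom_mult intro!: coeff_eq_0)

lemma coeff_sylvester_row_eq_0:
  fixes f g :: "'a::comm_ring_1 poly"
  assumes "degree f \<le> m" "degree g \<le> n" "i < m + n" "m + n \<le> k"
  shows "coeff (sylvester_row m n f g i) k = 0"
proof (cases "i < n")
  case True
  then show ?thesis using assms
    by (auto simp: sylvester_row_def intro!: coeff_monom_mult_degree_less[of _ m])
next
  case False
  then show ?thesis using assms
    by (auto simp: sylvester_row_def intro!: coeff_monom_mult_degree_less[of _ n])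
qed

text \<open>As a form, \<open>g\<close> acquires the factor v^k, and each root at infinity
  contributes the value \<open>coeff f m\<close> of \<open>f\<close> there. In the matrix, the
  \<open>k\<close> new rows give an upper triangular block with zeros below it.\<close>

lemma resultant_sub_raise_degree:
  fixes f g :: "'a::idom poly"
  assumes f: "degree f \<le> m" and g: "degree g \<le> n"
  shows "resultant_sub m (n + k) f g = coeff f m ^ k * resultant_sub m n f g"
proof -
  define S where "S = pmat (m + (n + k)) (sylvester_row m (n + k) f g)"
  define A where "A = mat k k (\<lambda>(i, j). S $$ (i, j))"
  define B where "B = mat k (m + n) (\<lambda>(i, j). S $$ (i, k + j))"
  define D where "D = pmat (m + n) (sylvester_row m n f g)"
  have S0: "S $$ (i, j) = 0" if "j < i" "i < k" for i j
    using that f by (auto simp: S_def pmat_index sylvester_row_def intro!: coeff_monom_mult_degree_less[of _ m])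
  have S1: "S $$ (i, i) = coeff f m" if "i < k" for i
    using that f by (auto simp: S_def pmat_index sylvester_row_def coeff_monom_mult)
  have S2: "S $$ (k + i, j) = 0" if "i < m + n" "j < k" for i j
  proof -
    have "sylvester_row m (n + k) f g (k + i) = sylvester_row m n f g i"
      using that by (auto simp: sylvester_row_def)
    then show ?thesis using that
      by (auto simp: S_def pmat_index intro!: coeff_sylvester_row_eq_0 f g)
  qed
  have S3: "S $$ (k + i, k + j) = D $$ (i, j)" if "i < m + n" "j < m + n" for i j
  proof -
    have "sylvester_row m (n + k) f g (k + i) = sylvester_row m n f g i"
      using that by (auto simp: sylvester_row_def)
    then show ?thesis using that by (auto simp: S_def D_def pmat_index)
  qed
  have "S = four_block_mat A B (0\<^sub>m (m + n) k) D"
  proof (rule eq_matI)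
    fix i j assume "i < dim_row (four_block_mat A B (0\<^sub>m (m + n) k) D)"
      "j < dim_col (four_block_mat A B (0\<^sub>m (m + n) k) D)"
    then have ij: "i < m + n + k" "j < m + n + k" by (auto simp: A_def D_def)
    show "S $$ (i, j) = four_block_mat A B (0\<^sub>m (m + n) k) D $$ (i, j)"
      using ij S2[of "i - k" j] S3[of "i - k" "j - k"]
      by (auto simp: A_def B_def D_def not_less)
  qed (auto simp: S_def A_def D_def)
  moreover have "det A = coeff f m ^ k"
    by (subst det_upper_triangular_prod[of _ k]) (auto simp: A_def S0 S1)
  moreover have "det (four_block_mat A B (0\<^sub>m (m + n) k) D) = det A * det D"
    by (rule det_four_block_mat_lower_left_zero[of _ k _ "m + n"]) (auto simp: A_def B_def D_def)
  ultimately have "det S = coeff f m ^ k * det D" by simp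
  then show ?thesis using f g by (simp add: resultant_sub_eq_pmat S_def D_def)
qed

text \<open>Two factorisations of the matrix with rows \<open>r\<close> (shifts of f1 f2, of f1 g
  and of g) are compared. The factor \<open>T\<close> produces \<open>coeff f1 m1 ^ m2\<close>, and
  so does raising the formal degree of \<open>g\<close> to \<open>n + m2\<close>; \<open>lc\<close>
  allows it to be cancelled.\<close>

lemma resultant_sub_mult_left_aux:
  fixes f1 f2 g :: "'a::idom poly"
  assumes f1: "degree f1 \<le> m1" and f2: "degree f2 \<le> m2" and g: "degree g \<le> n"
    and lc: "coeff f1 m1 \<noteq> 0"
  shows "resultant_sub (m1 + m2) n (f1 * f2) g = resultant_sub m1 n f1 g * resultant_sub m2 n f2 g"
proof -
  define N where "N = m1 + m2 + n"
  define r where "r i = (if i < n then monom 1 (n - 1 - i) * (f1 * f2)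
     else if i < n + m2 then monom 1 (n + m2 - 1 - i) * (f1 * g) else monom 1 (N - 1 - i) * g)" for i
  have f12: "degree (f1 * f2) \<le> m1 + m2"
    using degree_mult_le[of f1 f2] f1 f2 by linarith
  define T where "T = mat N N (\<lambda>(i, k).
     if n \<le> i \<and> i < n + m2 then (if n \<le> k then coeff (monom 1 (n + m2 - 1 - i) * f1) (N - 1 - k) else 0)
     else if i = k then 1 else (0::'a))"
  have T: "T \<in> carrier_mat N N" by (simp add: T_def)
  let ?g = "sylvester_row (m1 + m2) n (f1 * f2) g"
  have "pmat N r = T * pmat N ?g"
  proof (rule pmat_mult[OF T])
    fix i assume i: "i < N"
    define F where "F k = smult (T $$ (i, k)) (?g k)" for k
    have S: "(\<Sum>k<N. F k) = (\<Sum>k<n. F k) + (\<Sum>k<m1 + m2. F (n + k))"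
      using sum_lessThan_add[of F n "m1 + m2"] by (simp add: N_def add_ac)
    show "r i = (\<Sum>k<N. smult (T $$ (i, k)) (?g k))"
    proof (cases "n \<le> i \<and> i < n + m2")
      case False
      have "F k = (if k = i then r i else 0)" if "k < N" for k
        using that i False by (auto simp: F_def T_def r_def sylvester_row_def N_def)
      then have "(\<Sum>k<N. F k) = r i" using i by simp
      then show ?thesis by (simp add: F_def)
    next
      case True
      have "(\<Sum>k<n. F k) = 0"
        using i True by (intro sum.neutral) (auto simp: F_def T_def)
      moreover have "(\<Sum>k<m1 + m2. F (n + k)) = (\<Sum>k<m1 + m2. 
          smult (coeff (monom 1 (n + m2 - 1 - i) * f1) (m1 + m2 - 1 - k)) (monom 1 (m1 + m2 - 1 - k) * g))"
        using i True by (intro sum.cong) (auto simp: F_def T_def sylvester_row_def N_def)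
      moreover have "\<dots> = (monom 1 (n + m2 - 1 - i) * f1) * g"
        using i True f1
        by (intro mult_eq_sum_shifts[symmetric] coeff_monom_mult_degree_less[of _ m1]) auto
      ultimately show ?thesis using True S by (simp add: F_def r_def mult.assoc)
    qed
  qed
  moreover have "det T = coeff f1 m1 ^ m2"
  proof -
    have "det T = (\<Prod>i<N. T $$ (i, i))"
      using f1 by (intro det_upper_triangular_prod[OF T])
        (auto simp: T_def N_def intro!: coeff_monom_mult_degree_less[of _ m1])
    also have "\<dots> = (\<Prod>i<N. if i \<in> {n..<n + m2} then coeff f1 m1 else 1)"
      by (intro prod.cong) (auto simp: T_def N_def coeff_monom_mult)
    also have "\<dots> = (\<Prod>i\<in>{n..<n + m2}. coeff f1 m1)"
    proof -
      have "{..<N} \<inter> {n..<n + m2} = {n..<n + m2}" by (auto simp: N_def)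
      then show ?thesis by (subst prod.inter_restrict[symmetric]) auto
    qed
    finally show ?thesis by simp
  qed
  ultimately have 1: "det (pmat N r) = coeff f1 m1 ^ m2 * resultant_sub (m1 + m2) n (f1 * f2) g"
    using f12 g by (simp add: det_mult[OF T] resultant_sub_eq_pmat N_def)
  let ?M = "pmat (m2 + n) (sylvester_row m2 n f2 g)"
  \<comment> \<open>The first \<open>m2 + n\<close> rows of \<open>r\<close> are \<open>f1\<close>
    times the Sylvester rows of \<open>f2\<close> and \<open>g\<close>, hence combinations of the
    shifts of \<open>f1\<close>; the remaining rows are untouched.\<close>
  define U where "U = four_block_mat ?M (0\<^sub>m (m2 + n) m1) (0\<^sub>m m1 (m2 + n)) (1\<^sub>m m1)"
  have U: "U \<in> carrier_mat N N" by (auto simp: U_def N_def)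
  let ?h = "sylvester_row m1 (n + m2) f1 g"
  have "pmat N r = U * pmat N ?h"
  proof (rule pmat_mult[OF U])
    fix i assume i: "i < N"
    define F where "F k = smult (U $$ (i, k)) (?h k)" for k
    have S: "(\<Sum>k<N. F k) = (\<Sum>k<m2 + n. F k) + (\<Sum>k<m1. F (m2 + n + k))"
      using sum_lessThan_add[of F "m2 + n" "m1"] by (simp add: N_def add_ac)
    have U_ix: "U $$ (i, k) = (if i < m2 + n \<and> k < m2 + n then coeff (sylvester_row m2 n f2 g i) (m2 + n - 1 - k)
        else if i = k then 1 else 0)" if "k < N" for k
      using that i by (auto simp: U_def N_def pmat_index)
    show "r i = (\<Sum>k<N. smult (U $$ (i, k)) (?h k))"
    proof (cases "i < m2 + n")
      case False
      have "F k = (if k = i then r i else 0)" if "k < N" for k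
        using that i False by (auto simp: F_def U_ix r_def sylvester_row_def N_def add_ac)
      then have "(\<Sum>k<N. F k) = r i" using i by simp
      then show ?thesis by (simp add: F_def)
    next
      case True
      have "(\<Sum>k<m1. F (m2 + n + k)) = 0"
        using i True by (intro sum.neutral) (auto simp: F_def U_ix N_def)
      moreover have "(\<Sum>k<m2 + n. F k) = (\<Sum>k<m2 + n. 
          smult (coeff (sylvester_row m2 n f2 g i) (m2 + n - 1 - k)) (monom 1 (m2 + n - 1 - k) * f1))"
        using i True by (intro sum.cong) (auto simp: F_def U_ix sylvester_row_def N_def add.commute)
      moreover have "\<dots> = sylvester_row m2 n f2 g i * f1"
        using True f2 g
        by (intro mult_eq_sum_shifts[symmetric] coeff_sylvester_row_eq_0) auto
      moreover have "r i = sylvester_row m2 n f2 g i * f1"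
        using True by (auto simp: r_def sylvester_row_def add.commute)
      ultimately show ?thesis using S by (simp add: F_def)
    qed
  qed
  moreover have "det U = resultant_sub m2 n f2 g"
    using f2 g by (simp add: U_def det_four_block_mat_lower_left_zero[of _ "m2 + n" _ m1] resultant_sub_eq_pmat)
  ultimately have 2: "det (pmat N r) = resultant_sub m2 n f2 g * resultant_sub m1 (n + m2) f1 g"
    using f1 g by (simp add: det_mult[OF U] resultant_sub_eq_pmat N_def add_ac)
  show ?thesis
    using 1 2 lc f1 g by (simp add: resultant_sub_raise_degree mult_ac)
qed

text \<open>A polynomial identity that is known when the formal leading coefficient does not vanish
  is transferred to all polynomials by adding an indeterminate to that coefficient and setting
  the indeterminate to 0 afterwards.\<close>

definition generic_lead :: "nat \<Rightarrow> 'a::comm_ring_1 poly \<Rightarrow> 'a poly poly" where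
  "generic_lead m f = map_poly (\<lambda>x. [:x:]) f + monom [:0, 1:] m"

lemma degree_generic_lead: "degree f \<le> m \<Longrightarrow> degree (generic_lead m f) \<le> m"
  unfolding generic_lead_def
  by (intro degree_add_le order.trans[OF degree_map_poly_le] degree_monom_le)

lemma coeff_generic_lead: "coeff (generic_lead m f) m \<noteq> 0"
  by (simp add: generic_lead_def coeff_map_poly)

lemma specialise_generic_lead: "map_poly (\<lambda>p. poly p 0) (generic_lead m f) = f"
  by (rule poly_eqI) (simp add: generic_lead_def coeff_map_poly)

lemma specialise_const: "map_poly (\<lambda>p. poly p 0) (map_poly (\<lambda>x. [:x:]) f) = (f :: 'a::comm_ring_1 poly)"
  by (rule poly_eqI) (simp add: coeff_map_poly)

lemma resultant_sub_specialise:
  "poly (resultant_sub m n f g) (0::'a::comm_ring_1) =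
     resultant_sub m n (map_poly (\<lambda>p. poly p 0) f) (map_poly (\<lambda>p. poly p 0) g)"
  by (rule poly_hom.hom_resultant_sub)

lemma resultant_sub_mult_left:
  fixes f1 f2 g :: "'a::idom poly"
  assumes "degree f1 \<le> m1" "degree f2 \<le> m2" "degree g \<le> n"
  shows "resultant_sub (m1 + m2) n (f1 * f2) g = resultant_sub m1 n f1 g * resultant_sub m2 n f2 g"
proof -
  interpret ev: map_poly_comm_ring_hom "\<lambda>p. poly p (0::'a)" ..
  let ?c = "map_poly (\<lambda>x. [:x:])"
  have "resultant_sub (m1 + m2) n (generic_lead m1 f1 * ?c f2) (?c g) =
      resultant_sub m1 n (generic_lead m1 f1) (?c g) * resultant_sub m2 n (?c f2) (?c g)"
    by (intro resultant_sub_mult_left_aux degree_generic_lead coeff_generic_lead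
        order.trans[OF degree_map_poly_le] assms)
  from arg_cong[OF this, of "\<lambda>p. poly p 0"] show ?thesis
    by (simp add: resultant_sub_specialise ev.hom_mult specialise_generic_lead specialise_const)
qed

lemma resultant_sub_mult_right:
  fixes f g1 g2 :: "'a::idom poly"
  assumes "degree f \<le> m" "degree g1 \<le> n1" "degree g2 \<le> n2"
  shows "resultant_sub m (n1 + n2) f (g1 * g2) = resultant_sub m n1 f g1 * resultant_sub m n2 f g2"
  using resultant_sub_mult_left[of g1 n1 g2 n2 f m] assms
  by (simp add: resultant_sub_swap[of m] power_add algebra_simps)

section \<open>Homogeneous evaluation and cofactors\<close>

text \<open>Coordinates of the point are ring elements: \<open>hom\<close> is the value at
  (\<open>X2\<close>, \<open>Y2\<close>), and the value at (1, 0) is the formal leading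
  coefficient.\<close>

definition homog_eval :: "nat \<Rightarrow> 'a::comm_ring_1 poly \<Rightarrow> 'a \<Rightarrow> 'a \<Rightarrow> 'a" where
  "homog_eval m f x y = (\<Sum>i\<le>m. coeff f i * x ^ i * y ^ (m - i))"

lemma homog_eval_add: "homog_eval m (f + g) x y = homog_eval m f x y + homog_eval m g x y"
  by (simp add: homog_eval_def algebra_simps sum.distrib)

lemma homog_eval_smult: "homog_eval m (smult c f) x y = c * homog_eval m f x y"
  by (simp add: homog_eval_def sum_distrib_left mult.assoc)

lemma homog_eval_pCons:
  "homog_eval (Suc m) (pCons a f) x y = a * y ^ Suc m + x * homog_eval m f x y"
  by (simp add: homog_eval_def sum.atMost_Suc_shift sum_distrib_left algebra_simps del: sum.atMost_Suc)

lemma homog_eval_raise_degree: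
  assumes "degree f \<le> m"
  shows "homog_eval (m + k) f x y = y ^ k * homog_eval m f x y"
proof -
  have "(\<Sum>i\<le>m + k. coeff f i * x ^ i * y ^ (m + k - i)) = (\<Sum>i\<le>m. coeff f i * x ^ i * y ^ (m + k - i))"
    using assms by (intro sum.mono_neutral_right) (auto simp: coeff_eq_0)
  also have "\<dots> = (\<Sum>i\<le>m. y ^ k * (coeff f i * x ^ i * y ^ (m - i)))"
    by (intro sum.cong) (auto simp: algebra_simps simp flip: power_add)
  finally show ?thesis by (simp add: homog_eval_def sum_distrib_left)
qed

lemma homog_eval_mult:
  assumes "degree f \<le> m" "degree g \<le> k"
  shows "homog_eval (m + k) (f * g) x y = homog_eval m f x y * homog_eval k g x y"
  using assms
proof (induction m arbitrary: f)
  case 0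
  then obtain a where "f = [:a:]" by (auto elim: degree_eq_zeroE)
  then show ?case by (simp add: homog_eval_smult) (simp add: homog_eval_def)
next
  case (Suc m)
  obtain a f' where f: "f = pCons a f'" by (cases f)
  have f': "degree f' \<le> m" using Suc.prems f by (cases "f' = 0") auto
  have "homog_eval (Suc m + k) (f * g) x y =
      a * homog_eval (k + Suc m) g x y + x * homog_eval (m + k) (f' * g) x y"
    using homog_eval_pCons[of "m + k" 0 "f' * g"]
    by (simp add: f homog_eval_add homog_eval_smult add.commute)
  then show ?case
    using Suc.IH[OF f'] homog_eval_raise_degree[of g k "Suc m"] Suc.prems
    by (simp add: f homog_eval_pCons algebra_simps)
qed

lemma homog_eval_linear: "homog_eval 1 [:b, c:] x y = c * x + b * y"
  by (simp add: homog_eval_def)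

text \<open>Division by y s - x without inverting y: the factor y^m clears all denominators, and the
  remainder is the value of the form at the root (x : y).\<close>

lemma homogenised_division:
  fixes f :: "'a::comm_ring_1 poly"
  assumes "degree f \<le> m"
  obtains h where "\<And>i. i \<ge> m \<Longrightarrow> coeff h i = 0"
    "smult (y ^ m) f = h * [:- x, y:] + [:homog_eval m f x y:]"
proof -
  have "\<exists>h. (\<forall>i\<ge>m. coeff h i = 0) \<and> smult (y ^ m) f = h * [:- x, y:] + [:homog_eval m f x y:]"
    using assms
  proof (induction m arbitrary: f)
    case 0
    then obtain a where "f = [:a:]" by (auto elim: degree_eq_zeroE)
    then show ?case by (intro exI[of _ 0]) (simp add: homog_eval_def)
  next
    case (Suc m)
    obtain a f' where f: "f = pCons a f'" by (cases f)
    have f': "degree f' \<le> m" using Suc.prems f by (cases "f' = 0") auto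
    obtain h' where h': "\<forall>i\<ge>m. coeff h' i = 0"
      "smult (y ^ m) f' = h' * [:- x, y:] + [:homog_eval m f' x y:]"
      using Suc.IH[OF f'] by blast
    let ?H = "homog_eval m f' x y"
    have "smult (y ^ Suc m) f = [:a * y ^ Suc m:] + [:0, y:] * smult (y ^ m) f'"
      by (simp add: f mult.commute)
    also have "\<dots> = ([:0, y:] * h' + [:?H:]) * [:- x, y:] + [:homog_eval (Suc m) f x y:]"
      unfolding h'(2) by (simp add: f homog_eval_pCons algebra_simps)
    finally show ?case
      using h'(1)
      by (intro exI[of _ "[:0, y:] * h' + [:?H:]"]) (auto simp: coeff_pCons split: nat.split)
  qed
  then show ?thesis using that by blast
qed

section \<open>Resultants with constant and linear forms\<close>

lemma resultant_sub_const_left: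
  fixes g :: "'a::comm_ring_1 poly"
  shows "resultant_sub 0 n [:c:] g = c ^ n"
proof -
  have "det (sylvester_mat_sub 0 n [:c:] g) = (\<Prod>i<n. sylvester_mat_sub 0 n [:c:] g $$ (i, i))"
    by (rule det_upper_triangular_prod) (auto simp: sylvester_mat_sub_index)
  also have "\<dots> = c ^ n" by (simp add: sylvester_mat_sub_index)
  finally show ?thesis by (simp add: resultant_sub_def)
qed

lemma resultant_sub_const_right:
  fixes f :: "'a::comm_ring_1 poly"
  shows "resultant_sub m 0 f [:c:] = c ^ m"
  using resultant_sub_swap[of m 0 f "[:c:]"] by (simp add: resultant_sub_const_left)

lemma resultant_sub_smult_left:
  fixes f g :: "'a::idom poly"
  assumes "degree f \<le> m" "degree g \<le> n"
  shows "resultant_sub m n (smult c f) g = c ^ n * resultant_sub m n f g"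
  using resultant_sub_mult_left[of "[:c:]" 0 f m g n] assms by (simp add: resultant_sub_const_left)

lemma resultant_sub_smult_right:
  fixes f g :: "'a::idom poly"
  assumes "degree f \<le> m" "degree g \<le> n"
  shows "resultant_sub m n f (smult c g) = c ^ m * resultant_sub m n f g"
  using resultant_sub_mult_right[of f m "[:c:]" 0 g n] assms by (simp add: resultant_sub_const_right)

lemma resultant_sub_raise_degree_left:
  fixes f g :: "'a::idom poly"
  assumes f: "degree f \<le> m" and g: "degree g \<le> n"
  shows "resultant_sub (Suc m) n f g = (-1) ^ n * coeff g n * resultant_sub m n f g"
proof -
  have "resultant_sub (Suc m) n f g = (-1) ^ (Suc m * n) * resultant_sub n (m + 1) g f"
    using resultant_sub_swap[of "Suc m" n f g] by simp
  also have "\<dots> = (-1) ^ (Suc m * n) * (coeff g n * ((-1) ^ (n * m) * resultant_sub m n f g))"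
    by (subst resultant_sub_raise_degree[OF g f], subst resultant_sub_swap) simp
  also have "\<dots> = (-1) ^ (2 * (n * m) + n) * (coeff g n * resultant_sub m n f g)"
    by (simp add: power_add algebra_simps)
  also have "(-1) ^ (2 * (n * m) + n) = (-1 :: 'a) ^ n"
    by (simp add: power_add power_mult)
  finally show ?thesis by (simp add: mult.assoc)
qed

lemma resultant_sub_one_linear:
  fixes x y :: "'a::idom"
  shows "resultant_sub m 1 1 [:x, y:] = (- y) ^ m"
proof (induction m)
  case 0
  show ?case using resultant_sub_const_left[of 1 1 "[:x, y:]"] by (simp add: one_pCons)
next
  case (Suc m)
  have "resultant_sub (Suc m) 1 1 [:x, y:] = - y * resultant_sub m 1 1 [:x, y:]"
    by (subst resultant_sub_raise_degree_left) auto
  then show ?case using Suc by simp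
qed

text \<open>Product formula for the single root (x : y). If y is nonzero, y^m f is reduced modulo
  the linear form to the constant \<open>?H\<close> and powers of y cancel; if y = 0, the root lies
  at infinity.\<close>

lemma resultant_sub_linear_right:
  fixes f :: "'a::idom poly"
  assumes f: "degree f \<le> m"
  shows "resultant_sub m 1 f [:- x, y:] = (-1) ^ m * homog_eval m f x y"
proof (cases "y = 0")
  case True
  have "homog_eval m f x 0 = (\<Sum>i\<le>m. if i = m then coeff f m * x ^ m else 0)"
    unfolding homog_eval_def by (intro sum.cong) auto
  then have "homog_eval m f x 0 = coeff f m * x ^ m" by simp
  moreover have "resultant_sub m (0 + 1) f [:- x:] = coeff f m * (- x) ^ m"
    by (subst resultant_sub_raise_degree) (auto simp: f resultant_sub_const_right)
  ultimately show ?thesis by (simp add: True power_minus[of x])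
next
  case False
  let ?H = "homog_eval m f x y"
  obtain h where h: "\<And>i. i \<ge> m \<Longrightarrow> coeff h i = 0" "smult (y ^ m) f = h * [:- x, y:] + [:?H:]"
    using homogenised_division[OF f] by metis
  have "y ^ m * resultant_sub m 1 f [:- x, y:] = resultant_sub m 1 ([:?H:] + h * [:- x, y:]) [:- x, y:]"
    using resultant_sub_smult_left[of f m "[:- x, y:]" 1 "y ^ m"] f h(2) by (simp add: add.commute)
  also have "\<dots> = resultant_sub m 1 [:?H:] [:- x, y:]"
  proof (cases m)
    case 0
    then have "h = 0" using h(1) by (intro poly_eqI) auto
    then show ?thesis by simp
  next
    case (Suc k)
    have "degree h \<le> k" using h(1) Suc by (intro degree_le) auto
    then show ?thesis using Suc by (intro resultant_sub_add_mult_left) auto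
  qed
  also have "\<dots> = ?H * (- y) ^ m"
    using resultant_sub_smult_left[of 1 m "[:- x, y:]" 1 ?H] resultant_sub_one_linear[of m "- x" y]
    by (simp add: smult_one)
  finally show ?thesis using False by (simp add: power_minus[of y])
qed

section \<open>Cofactors of a matrix with known kernel vectors\<close>

lemma cofactor_transpose:
  assumes "A \<in> carrier_mat n n" "i < n" "j < n"
  shows "cofactor (transpose_mat A) i j = cofactor A j i"
proof -
  have "mat_delete (transpose_mat A) i j = transpose_mat (mat_delete A j i)"
    using assms by (intro eq_matI) (auto simp: mat_delete_def)
  then show ?thesis
    using assms det_transpose[OF mat_delete_carrier[OF assms(1), of j i]]
    by (simp add: cofactor_def add.commute)
qed

text \<open>Column \<open>l\<close> of \<open>A\<close> is replaced by z_k e_j - z_j e_k, which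
  \<open>z\<close> annihilates too. The new matrix \<open>B\<close> is therefore singular, and
  expansion of its determinant along that column is the claim.\<close>

lemma cofactor_left_kernel:
  fixes A :: "'a::idom mat"
  assumes A: "A \<in> carrier_mat n n"
    and z: "\<And>j. j < n \<Longrightarrow> (\<Sum>i<n. z i * A $$ (i, j)) = 0"
    and ix: "j < n" "k < n" "l < n"
  shows "z k * cofactor A j l = z j * cofactor A k l"
proof (cases "j = k \<or> (\<forall>i<n. z i = 0)")
  case True
  then show ?thesis using ix by auto
next
  case False
  then obtain i0 where i0: "i0 < n" "z i0 \<noteq> 0" and jk: "j \<noteq> k" by blast
  define B where "B = mat n n (\<lambda>(i, c). if c = l then (if i = j then z k else if i = k then - z j else 0)
     else A $$ (i, c))"
  have B: "B \<in> carrier_mat n n" by (simp add: B_def)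
  have cof: "cofactor B i l = cofactor A i l" if "i < n" for i
  proof -
    have "mat_delete B i l = mat_delete A i l"
      using A ix that by (intro eq_matI) (auto simp: mat_delete_def B_def)
    then show ?thesis by (simp add: cofactor_def)
  qed
  have "det B = (\<Sum>i<n. B $$ (i, l) * cofactor B i l)"
    using laplace_expansion_column[OF B ix(3)] .
  also have "\<dots> = (\<Sum>i<n. (if i = j then z k * cofactor A j l else 0) + (if i = k then - z j * cofactor A k l else 0))"
    using ix jk by (intro sum.cong) (auto simp: B_def cof[unfolded B_def])
  also have "\<dots> = z k * cofactor A j l - z j * cofactor A k l"
    using ix by (simp add: sum.distrib)
  finally have det: "det B = z k * cofactor A j l - z j * cofactor A k l" .
  have zB: "(\<Sum>i<n. z i * B $$ (i, c)) = 0" if c: "c < n" for c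
  proof (cases "c = l")
    case True
    have "(\<Sum>i<n. z i * B $$ (i, c)) = (\<Sum>i<n. (if i = j then z j * z k else 0) + (if i = k then - z j * z k else 0))"
      using ix jk True by (intro sum.cong) (auto simp: B_def)
    then show ?thesis using ix by (simp add: sum.distrib)
  next
    case False
    then have "(\<Sum>i<n. z i * B $$ (i, c)) = (\<Sum>i<n. z i * A $$ (i, c))"
      using c by (intro sum.cong) (auto simp: B_def)
    then show ?thesis using z[OF c] by simp
  qed
  have "transpose_mat B *\<^sub>v vec n z = 0\<^sub>v n"
    using zB B by (intro eq_vecI) (auto simp: scalar_prod_def lessThan_atLeast0 mult.commute)
  moreover have "vec n z \<noteq> 0\<^sub>v n" using i0 by (auto dest!: arg_cong[of _ _ "\<lambda>v. v $ i0"])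
  ultimately have "det (transpose_mat B) = 0"
    using det_0_iff_vec_prod_zero[of "transpose_mat B" n] B by (metis transpose_carrier_mat vec_carrier)
  then show ?thesis using det det_transpose[OF B] by simp
qed

lemma cofactor_right_kernel:
  fixes A :: "'a::idom mat"
  assumes A: "A \<in> carrier_mat n n"
    and w: "\<And>i. i < n \<Longrightarrow> (\<Sum>j<n. A $$ (i, j) * w j) = 0"
    and ix: "j < n" "k < n" "l < n"
  shows "w k * cofactor A l j = w j * cofactor A l k"
  using cofactor_left_kernel[of "transpose_mat A" n w j k l] A w ix
  by (simp add: cofactor_transpose mult.commute)

text \<open>The kernel vectors \<open>z\<close> and \<open>w\<close> determine all cofactors up to
  one common factor, which is found from the corner cofactor. Dividing by \<open>z 0 * w 0\<close>
  is what \<open>lc\<close> and \<open>x \<noteq> 0\<close> are for.\<close>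

lemma cofactor_sylvester_common_linear_factor_aux:
  fixes f g :: "'a::idom poly"
  assumes f: "degree f \<le> m" and g: "degree g \<le> n" and x: "x \<noteq> 0" and lc: "coeff g n \<noteq> 0"
    and ij: "i < Suc m + Suc n" "j < Suc m + Suc n"
  shows "cofactor (sylvester_mat_sub (Suc m) (Suc n) ([:- x, y:] * f) ([:- x, y:] * g)) i j =
    (-1) ^ Suc m * resultant_sub m n f g *
      (if i < Suc n then coeff g (Suc n - 1 - i) else - coeff f (Suc m - 1 - (i - Suc n))) *
      (x ^ (m + Suc n - j) * y ^ j)"
proof -
  define L where "L = [:- x, y:]"
  define N where "N = Suc m + Suc n"
  define S where "S = sylvester_mat_sub (Suc m) (Suc n) (L * f) (L * g)"
  define z where "z i = (if i < Suc n then coeff g (Suc n - 1 - i) else - coeff f (Suc m - 1 - (i - Suc n)))" for i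
  define w where "w j = x ^ (N - 1 - j) * y ^ j" for j
  let ?row = "sylvester_row (Suc m) (Suc n) (L * f) (L * g)"
  have L: "degree L \<le> 1" by (simp add: L_def)
  have Lf: "degree (L * f) \<le> Suc m" and Lg: "degree (L * g) \<le> Suc n"
    using degree_mult_le[of L f] degree_mult_le[of L g] L f g by linarith+
  have S: "S = pmat N ?row"
    unfolding S_def N_def by (rule sylvester_mat_sub_eq_pmat[OF Lf Lg])
  have SC: "S \<in> carrier_mat N N" by (simp add: S)
  have f0: "coeff f k = 0" if "k \<ge> Suc m" for k
    using f that by (intro coeff_eq_0) auto
  have g0: "coeff g k = 0" if "k \<ge> Suc n" for k
    using g that by (intro coeff_eq_0) auto
  have "(\<Sum>k<Suc n + Suc m. smult (z k) (?row k)) =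
      (\<Sum>k<Suc n. smult (z k) (?row k)) + (\<Sum>k<Suc m. smult (z (Suc n + k)) (?row (Suc n + k)))"
    by (rule sum_lessThan_add)
  also have "(\<Sum>k<Suc n. smult (z k) (?row k)) =
      (\<Sum>k<Suc n. smult (coeff g (Suc n - 1 - k)) (monom 1 (Suc n - 1 - k) * (L * f)))"
    by (intro sum.cong) (auto simp: z_def sylvester_row_def)
  also have "\<dots> = g * (L * f)"
    by (rule mult_eq_sum_shifts[symmetric]) (rule g0)
  also have "(\<Sum>k<Suc m. smult (z (Suc n + k)) (?row (Suc n + k))) =
      - (\<Sum>k<Suc m. smult (coeff f (Suc m - 1 - k)) (monom 1 (Suc m - 1 - k) * (L * g)))"
    unfolding sum_negf[symmetric]
    by (intro sum.cong) (auto simp: z_def sylvester_row_def)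
  also have "(\<Sum>k<Suc m. smult (coeff f (Suc m - 1 - k)) (monom 1 (Suc m - 1 - k) * (L * g))) = f * (L * g)"
    by (rule mult_eq_sum_shifts[symmetric]) (rule f0)
  finally have "(\<Sum>k<N. smult (z k) (?row k)) = 0"
    by (simp add: N_def add.commute mult.left_commute)
  then have zrow: "(\<Sum>k<N. z k * coeff (?row k) e) = 0" for e
    using coeff_sum[of "\<lambda>k. smult (z k) (?row k)" "{..<N}" e] by simp
  have zS: "(\<Sum>i<N. z i * S $$ (i, j)) = 0" if "j < N" for j
    using that zrow[of "N - 1 - j"] by (simp add: S pmat_index)
  have wS: "(\<Sum>j<N. S $$ (i, j) * w j) = 0" if i: "i < N" for i
  proof -
    define h where "h = (if i < Suc n then monom 1 (Suc n - 1 - i) * f else monom 1 (N - 1 - i) * g)"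
    have row: "?row i = L * h" by (auto simp: sylvester_row_def h_def N_def)
    have h: "degree h \<le> m + n"
    proof (rule degree_le, intro allI impI)
      fix k assume "m + n < k"
      then show "coeff h k = 0"
        using i coeff_monom_mult_degree_less[OF f, of "Suc n - 1 - i" k]
          coeff_monom_mult_degree_less[OF g, of "N - 1 - i" k]
        by (auto simp: h_def N_def)
    qed
    have "(\<Sum>j<N. S $$ (i, j) * w j) = (\<Sum>j<N. coeff (L * h) (N - 1 - j) * (x ^ (N - 1 - j) * y ^ j))"
      using i by (simp add: S pmat_index row w_def)
    also have "\<dots> = (\<Sum>j<N. coeff (L * h) (N - 1 - j) * (x ^ (N - 1 - j) * y ^ (N - 1 - (N - 1 - j))))"
      by (intro sum.cong) auto
    also have "\<dots> = (\<Sum>j<N. coeff (L * h) j * (x ^ j * y ^ (N - 1 - j)))"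
      using sum.nat_diff_reindex[of "\<lambda>j. coeff (L * h) j * (x ^ j * y ^ (N - 1 - j))" N] by simp
    also have "\<dots> = homog_eval (1 + (m + n)) (L * h) x y"
    proof -
      have "{..<N} = {..1 + (m + n)}" by (auto simp: N_def)
      then show ?thesis by (simp add: homog_eval_def N_def mult.assoc)
    qed
    also have "\<dots> = homog_eval 1 L x y * homog_eval (m + n) h x y"
      using L h by (rule homog_eval_mult)
    also have "\<dots> = 0" unfolding L_def homog_eval_linear by (simp add: algebra_simps)
    finally show ?thesis .
  qed
  let ?r = "sylvester_row (Suc m) n f g"
  \<comment> \<open>Without the first row, the rows are \<open>L\<close> times the Sylvester rows of
    \<open>f\<close> and \<open>g\<close> for formal degrees \<open>Suc m\<close> and
    \<open>n\<close>. The degree of \<open>f\<close> is thus one too large, and this yields the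
    factor \<open>coeff g n\<close>, which is \<open>z 0\<close>.\<close>
  have del: "mat_delete S 0 0 = pmat (N - 1) (\<lambda>i. ?r i * L)"
  proof (rule eq_matI)
    fix i j assume "i < dim_row (pmat (N - 1) (\<lambda>i. ?r i * L))" "j < dim_col (pmat (N - 1) (\<lambda>i. ?r i * L))"
    then have ij: "i < N - 1" "j < N - 1" by auto
    have "?row (Suc i) = ?r i * L"
      by (auto simp: sylvester_row_def mult_ac)
    then show "mat_delete S 0 0 $$ (i, j) = pmat (N - 1) (\<lambda>i. ?r i * L) $$ (i, j)"
      using ij by (simp add: mat_delete_def S pmat_index)
  qed (simp_all add: S)
  \<comment> \<open>Multiplication by \<open>L\<close> as a matrix; the top coefficient that is cut
    off belongs to the deleted column, and the diagonal is -x throughout.\<close>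
  define M where "M = pmat (N - 1) (\<lambda>k. monom 1 (N - 1 - 1 - k) * L)"
  have rs: "pmat (N - 1) ?r = sylvester_mat_sub (Suc m) n f g"
    using f g by (simp add: N_def sylvester_mat_sub_eq_pmat)
  have "pmat (N - 1) (\<lambda>i. ?r i * L) = pmat (N - 1) ?r * M"
    unfolding M_def
  proof (rule pmat_mult)
    fix i assume i: "i < N - 1"
    have "?r i * L = (\<Sum>k<N - 1. smult (coeff (?r i) (N - 1 - 1 - k)) (monom 1 (N - 1 - 1 - k) * L))"
      using i f g by (intro mult_eq_sum_shifts coeff_sylvester_row_eq_0) (auto simp: N_def)
    then show "?r i * L = (\<Sum>k<N - 1. smult (pmat (N - 1) ?r $$ (i, k)) (monom 1 (N - 1 - 1 - k) * L))"
      using i by (simp add: pmat_index)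
  qed simp
  moreover have "det M = (\<Prod>k<N - 1. M $$ (k, k))"
    unfolding M_def
    by (rule det_lower_triangular_prod) (auto simp: pmat_index coeff_monom_mult)
  moreover have "(\<Prod>k<N - 1. M $$ (k, k)) = (- x) ^ (N - 1)"
  proof -
    have "M $$ (k, k) = coeff L 0" if "k < N - 1" for k
      using that by (simp add: M_def pmat_index coeff_monom_mult)
    then show ?thesis by (simp add: L_def)
  qed
  ultimately have "cofactor S 0 0 = resultant_sub (Suc m) n f g * (- x) ^ (N - 1)"
    using det_mult[of "pmat (N - 1) ?r" "N - 1" M, OF pmat_carrier]
    by (simp add: cofactor_def del rs[unfolded One_nat_def] resultant_sub_def M_def)
  also have "\<dots> = (-1) ^ n * (-1) ^ (N - 1) * (coeff g n * resultant_sub m n f g * x ^ (N - 1))"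
    by (simp add: resultant_sub_raise_degree_left f g power_minus[of x] mult_ac)
  also have "(-1) ^ n * (-1) ^ (N - 1) = (-1 :: 'a) ^ (2 * n + Suc m)"
    unfolding power_add[symmetric] by (rule arg_cong[of _ _ "power (-1)"]) (simp add: N_def)
  also have "\<dots> = (-1) ^ Suc m" by (simp add: power_add power_mult)
  finally have c00: "cofactor S 0 0 = (-1) ^ Suc m * resultant_sub m n f g * z 0 * w 0"
    by (simp add: z_def w_def)
  have N: "0 < N" "i < N" "j < N" using ij by (auto simp: N_def)
  have "z 0 * w 0 * cofactor S i j = w 0 * (z i * cofactor S 0 j)"
    using cofactor_left_kernel[OF SC zS N(2) N(1) N(3)] by (simp add: mult_ac)
  also have "\<dots> = z i * w j * cofactor S 0 0"
    using cofactor_right_kernel[OF SC wS N(3) N(1) N(1)] by (simp add: mult_ac)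
  also have "\<dots> = z 0 * w 0 * ((-1) ^ Suc m * resultant_sub m n f g * z i * w j)"
    by (simp add: c00 mult_ac)
  finally have "cofactor S i j = (-1) ^ Suc m * resultant_sub m n f g * z i * w j"
    using x lc by (simp add: z_def w_def del: power_Suc)
  then show ?thesis
    unfolding S_def L_def z_def w_def N_def by simp
qed

lemma (in comm_ring_hom) hom_cofactor:
  "hom (cofactor A i j) = cofactor (map_mat hom A) i j" if "A \<in> carrier_mat n n" "i < n" "j < n"
proof -
  have "map_mat hom (mat_delete A i j) = mat_delete (map_mat hom A) i j"
    using that by (intro eq_matI) (auto simp: mat_delete_def)
  then show ?thesis by (simp add: cofactor_def hom_distribs flip: hom_det)
qed

text \<open>The condition on the leading coefficient of \<open>g\<close> is removed by specialising
  from \<open>generic_lead\<close>.\<close>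

lemma cofactor_sylvester_common_linear_factor:
  fixes f g :: "'a::idom poly"
  assumes f: "degree f \<le> m" and g: "degree g \<le> n" and x: "x \<noteq> 0"
    and ij: "i < Suc m + Suc n" "j < Suc m + Suc n"
  shows "cofactor (sylvester_mat_sub (Suc m) (Suc n) ([:- x, y:] * f) ([:- x, y:] * g)) i j =
    (-1) ^ Suc m * resultant_sub m n f g *
      (if i < Suc n then coeff g (Suc n - 1 - i) else - coeff f (Suc m - 1 - (i - Suc n))) *
      (x ^ (m + Suc n - j) * y ^ j)"
proof -
  interpret ev: map_poly_comm_ring_hom "\<lambda>p. poly p (0::'a)" ..
  let ?c = "map_poly (\<lambda>x. [:x:])"
  let ?f = "?c f" and ?g = "generic_lead n g"
  let ?S = "sylvester_mat_sub (Suc m) (Suc n) ([:- [:x:], [:y:]:] * ?f) ([:- [:x:], [:y:]:] * ?g)"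
  have S: "?S \<in> carrier_mat (Suc m + Suc n) (Suc m + Suc n)" by auto
  have cf: "poly (coeff ?f k) 0 = coeff f k" and cg: "poly (coeff ?g k) 0 = coeff g k" for k
    using specialise_const[of f] specialise_generic_lead[of n g]
    by (metis coeff_map_poly poly_0)+
  have "cofactor ?S i j = (-1) ^ Suc m * resultant_sub m n ?f ?g *
      (if i < Suc n then coeff ?g (Suc n - 1 - i) else - coeff ?f (Suc m - 1 - (i - Suc n))) *
      ([:x:] ^ (m + Suc n - j) * [:y:] ^ j)"
    using f g x ij
    by (intro cofactor_sylvester_common_linear_factor_aux order.trans[OF degree_map_poly_le] degree_generic_lead
        coeff_generic_lead) auto
  from arg_cong[OF this, of "\<lambda>p. poly p 0"]
  have "poly (cofactor ?S i j) 0 = (-1) ^ Suc m * resultant_sub m n f g *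
      (if i < Suc n then coeff g (Suc n - 1 - i) else - coeff f (Suc m - 1 - (i - Suc n))) *
      (x ^ (m + Suc n - j) * y ^ j)"
    by (simp add: resultant_sub_specialise specialise_generic_lead specialise_const cf cg)
  moreover have "map_poly (\<lambda>p. poly p 0) [:- [:x:], [:y:]:] = [:- x, y:]"
    by (rule poly_eqI) (simp add: coeff_map_poly coeff_pCons split: nat.split)
  then have "poly (cofactor ?S i j) 0 = cofactor (sylvester_mat_sub (Suc m) (Suc n) ([:- x, y:] * f) ([:- x, y:] * g)) i j"
    by (simp only: poly_hom.hom_cofactor[OF S ij] sylvester_mat_sub_map poly_0
        ev.hom_mult specialise_generic_lead specialise_const)
  ultimately show ?thesis by simp
qed

section \<open>Forms over the complex numbers\<close>

definition eq_const :: "complex poly poly \<Rightarrow> complex poly poly \<Rightarrow> bool" (infix "\<doteq>" 50) where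
  "f \<doteq> g \<longleftrightarrow> (\<exists>k. k \<noteq> 0 \<and> f = const2 k * g)"

lemma const2_add: "const2 (x + y) = const2 x + const2 y"
  and const2_mult: "const2 (x * y) = const2 x * const2 y"
  and const2_uminus: "const2 (- x) = - const2 x"
  and const2_diff: "const2 (x - y) = const2 x - const2 y"
  and const2_0 [simp]: "const2 0 = 0"
  and const2_1 [simp]: "const2 1 = 1"
  and const2_eq_0_iff [simp]: "const2 x = 0 \<longleftrightarrow> x = 0"
  by (simp_all add: const2_def one_pCons)

lemma const2_power: "const2 (x ^ k) = const2 x ^ k"
  by (induction k) (simp_all add: const2_mult)

lemma comm_ring_hom_const2: "comm_ring_hom const2"
  by unfold_locales (simp_all add: const2_add const2_mult)

lemma coeff_lift [simp]: "coeff (lift a) i = const2 (coeff a i)"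
  by (simp add: lift_def coeff_map_poly)

lemma degree_lift [simp]: "degree (lift a) = degree a"
  unfolding lift_def by (rule degree_map_poly) simp

lemma lift_add: "lift (a + b) = lift a + lift b"
  by (rule poly_eqI) (simp add: const2_add)

lemma lift_diff: "lift (a - b) = lift a - lift b"
  by (rule poly_eqI) (simp add: const2_diff)

lemma lift_smult: "lift (smult k a) = smult (const2 k) (lift a)"
  by (rule poly_eqI) (simp add: const2_mult)

lemma lift_0 [simp]: "lift 0 = 0"
  by (rule poly_eqI) simp

lemma lift_pCons: "lift (pCons x a) = pCons (const2 x) (lift a)"
  by (rule poly_eqI) (simp add: coeff_pCons split: nat.split)

lemma lift_mult: "lift (a * b) = lift a * lift b"
proof -
  interpret const2: comm_ring_hom const2 by (rule comm_ring_hom_const2)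
  interpret map_poly_comm_ring_hom const2 ..
  show ?thesis unfolding lift_def by (rule hom_mult)
qed

lemma poly_lift: "poly (lift a) (const2 r) = const2 (poly a r)"
  by (induction a) (simp_all add: lift_pCons const2_add const2_mult)

lemma hom_eq_homog_eval: "hom n a = homog_eval n (lift a) X2 Y2"
  by (simp add: hom_def homog_eval_def)

lemma hom_0 [simp]: "hom n 0 = 0"
  by (simp add: hom_def)

lemma hom_add: "hom n (a + b) = hom n a + hom n b"
  by (simp add: hom_eq_homog_eval homog_eval_add lift_add)

lemma hom_smult: "hom n (smult k a) = const2 k * hom n a"
  by (simp add: hom_eq_homog_eval homog_eval_smult lift_smult)

lemma hom_mult:
  "degree a \<le> m \<Longrightarrow> degree b \<le> k \<Longrightarrow> hom (m + k) (a * b) = hom m a * hom k b"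
  by (simp add: hom_eq_homog_eval lift_mult homog_eval_mult)

text \<open>Setting the inner variable Y2 to 1 inverts homogenisation.\<close>

definition dehom :: "complex poly poly \<Rightarrow> complex poly" where
  "dehom = map_poly (\<lambda>p. poly p 1)"

lemma dehom_add: "dehom (f + g) = dehom f + dehom g"
  and dehom_mult: "dehom (f * g) = dehom f * dehom g"
  and dehom_power: "dehom (f ^ k) = dehom f ^ k"
  and dehom_sum: "dehom (sum F A) = (\<Sum>x\<in>A. dehom (F x))"
  and dehom_0 [simp]: "dehom 0 = 0"
proof -
  interpret map_poly_comm_ring_hom "\<lambda>p. poly p (1::complex)" ..
  show "dehom (f + g) = dehom f + dehom g" "dehom (f * g) = dehom f * dehom g"
    "dehom (f ^ k) = dehom f ^ k" "dehom (sum F A) = (\<Sum>x\<in>A. dehom (F x))" "dehom 0 = 0"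
    unfolding dehom_def by (simp_all add: hom_add hom_mult hom_power hom_sum)
qed

lemma dehom_const2: "dehom (const2 x) = [:x:]"
  and dehom_X2: "dehom X2 = [:0, 1:]"
  and dehom_Y2: "dehom Y2 = 1"
  by (rule poly_eqI; simp add: dehom_def const2_def X2_def Y2_def coeff_map_poly coeff_pCons one_pCons split: nat.split)+

lemma dehom_hom: "degree a \<le> n \<Longrightarrow> dehom (hom n a) = a"
proof -
  assume a: "degree a \<le> n"
  have "dehom (hom n a) = (\<Sum>i\<le>n. monom (coeff a i) i)"
    by (simp add: hom_def dehom_sum dehom_mult dehom_power dehom_const2 dehom_X2 dehom_Y2 monom_altdef)
  also have "\<dots> = a" using a by (rule poly_as_sum_of_monoms')
  finally show ?thesis .
qed

lemma hom_eq_0_iff: "degree a \<le> n \<Longrightarrow> hom n a = 0 \<longleftrightarrow> a = 0"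
  using dehom_hom[of a n] by auto

lemma eq_const_refl [simp]: "f \<doteq> f"
  unfolding eq_const_def by (intro exI[of _ 1]) simp

lemma eq_const_sym: "f \<doteq> g \<Longrightarrow> g \<doteq> f"
  unfolding eq_const_def
proof (elim exE conjE)
  fix k :: complex assume "k \<noteq> 0" "f = const2 k * g"
  then show "\<exists>k. k \<noteq> 0 \<and> g = const2 k * f"
    by (intro exI[of _ "1 / k"]) (simp flip: mult.assoc const2_mult)
qed

lemma eq_const_trans [trans]: "f \<doteq> g \<Longrightarrow> g \<doteq> h \<Longrightarrow> f \<doteq> h"
  unfolding eq_const_def by (metis const2_mult mult.assoc no_zero_divisors)

lemma eq_const_mult: "f \<doteq> g \<Longrightarrow> f' \<doteq> g' \<Longrightarrow> f * f' \<doteq> g * g'"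
  unfolding eq_const_def
proof (elim exE conjE)
  fix k k' :: complex assume "k \<noteq> 0" "f = const2 k * g" "k' \<noteq> 0" "f' = const2 k' * g'"
  then show "\<exists>k. k \<noteq> 0 \<and> f * f' = const2 k * (g * g')"
    by (intro exI[of _ "k * k'"]) (simp add: const2_mult mult_ac)
qed

lemma eq_const_cancel: "f * h \<doteq> g * h \<Longrightarrow> h \<noteq> 0 \<Longrightarrow> f \<doteq> g"
  unfolding eq_const_def by (metis mult.assoc mult_cancel_right)

lemma eq_const_const2_mult: "k \<noteq> 0 \<Longrightarrow> const2 k * f \<doteq> f"
  unfolding eq_const_def by blast

lemma eq_const_minus_one_power: "(-1) ^ k * f \<doteq> f"
  using eq_const_const2_mult[of "(-1) ^ k" f] by (simp add: const2_power const2_uminus)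

lemma eq_const_swap: "resultant_sub m n f g \<doteq> resultant_sub n m g f"
  by (subst resultant_sub_swap) (rule eq_const_minus_one_power)

text \<open>Units of C[x,y] are the nonzero constants, so the relation is that of being associated.
  Two divisibilities thus supply the constant that the theorem asks for.\<close>

lemma eq_const_iff_dvd: "f \<doteq> g \<longleftrightarrow> f dvd g \<and> g dvd f"
proof
  assume "f \<doteq> g"
  then show "f dvd g \<and> g dvd f"
    using eq_const_sym[of f g] unfolding eq_const_def by (metis dvd_triv_right)
next
  assume fg: "f dvd g \<and> g dvd f"
  show "f \<doteq> g"
  proof (cases "g = 0")
    case True
    then show ?thesis using fg by simp
  next
    case False
    obtain u where u: "f = g * u" using fg by (auto elim: dvdE)
    moreover obtain v where v: "g = f * v" using fg by (auto elim: dvdE)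
    ultimately have "g * 1 = g * (u * v)" by (metis mult.assoc mult.right_neutral)
    then have "u dvd 1" using False by (metis dvd_triv_left mult_cancel_left)
    then obtain w where w: "u = [:w:]" "w dvd 1" by (auto simp: is_unit_poly_iff)
    then obtain k where "w = [:k:]" "k \<noteq> 0"
      by (metis is_unit_poly_iff not_is_unit_0)
    then show ?thesis using u w by (auto simp: eq_const_def const2_def intro!: exI[of _ k])
  qed
qed

text \<open>Since \<open>c\<close> splits over the complex numbers, the resultant is, up to a
  nonzero constant, the product of the values of \<open>f\<close> at the roots of \<open>c\<close>,
  infinity included. The induction on the formal degree strips one root at a time.\<close>

lemma resultant_sub_lift_neq_0:
  assumes f: "degree f \<le> m" and c: "degree c \<le> k" and c0: "c \<noteq> 0"
    and roots: "\<And>r. poly c r = 0 \<Longrightarrow> poly f (const2 r) \<noteq> 0"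
    and inf: "coeff c k = 0 \<Longrightarrow> coeff f m \<noteq> 0"
  shows "resultant_sub m k f (lift c) \<noteq> 0"
  using c c0 roots inf
proof (induction k arbitrary: c)
  case 0
  then obtain x where "c = [:x:]" by (auto elim: degree_eq_zeroE)
  then show ?case using 0 by (simp add: lift_pCons resultant_sub_const_right)
next
  case (Suc k)
  show ?case
  proof (cases "coeff c (Suc k) = 0")
    case True
    have c: "degree c \<le> k" using Suc.prems(1) True
      by (metis Suc.prems(2) le_Suc_eq leading_coeff_0_iff)
    have "resultant_sub m (k + 1) f (lift c) = coeff f m ^ 1 * resultant_sub m k f (lift c)"
      by (rule resultant_sub_raise_degree) (use f c in auto)
    then show ?thesis using Suc.IH[OF c] Suc.prems True by simp
  next
    case False
    have deg: "degree c = Suc k" using Suc.prems(1) False by (meson le_antisym le_degree)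
    obtain r where r: "poly c r = 0"
      using fundamental_theorem_of_algebra[of c] deg by (auto simp: constant_degree)
    then obtain c' where c': "c = [:- r, 1:] * c'" by (auto simp: poly_eq_0_iff_dvd elim: dvdE)
    have "c' \<noteq> 0" using c' Suc.prems(2) by auto
    then have d': "degree c' = k"
      using deg by (simp only: c') (subst (asm) degree_mult_eq; simp)
    then have "coeff c' k \<noteq> 0" using \<open>c' \<noteq> 0\<close> by auto
    have "resultant_sub m (1 + k) f (lift [:- r, 1:] * lift c') =
        resultant_sub m 1 f (lift [:- r, 1:]) * resultant_sub m k f (lift c')"
      by (rule resultant_sub_mult_right) (use f d' in auto)
    moreover have "resultant_sub m 1 f (lift [:- r, 1:]) = (-1) ^ m * poly f (const2 r)"
    proof -
      have "homog_eval m f (const2 r) 1 = poly f (const2 r)"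
        using homog_eval_raise_degree[of f "degree f" "m - degree f" "const2 r" 1] f
        by (simp add: homog_eval_def poly_altdef)
      then show ?thesis
        using resultant_sub_linear_right[OF f, of "const2 r" 1]
        by (simp add: lift_pCons const2_uminus)
    qed
    moreover have "resultant_sub m k f (lift c') \<noteq> 0"
      using Suc.prems c' d' \<open>c' \<noteq> 0\<close> \<open>coeff c' k \<noteq> 0\<close> by (intro Suc.IH) auto
    moreover have "lift c = lift [:- r, 1:] * lift c'" unfolding c' by (rule lift_mult)
    moreover have "poly f (const2 r) \<noteq> 0" using Suc.prems(3)[OF r] .
    ultimately show ?thesis by simp
  qed
qed

lemma resultant_sub_lift_lift:
  "resultant_sub m n (lift a) (lift b) = const2 (resultant_sub m n a b)"
  unfolding lift_def by (simp add: comm_ring_hom.hom_resultant_sub[OF comm_ring_hom_const2])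

text \<open>In the next lemma F and G are obtained from P and Q by the polynomial matrix with rows
  (-q2, p2) and (q1, -p1), whose determinant is a multiple of c.\<close>

lemma resultant_quotients:
  fixes P Q F G :: "complex poly poly poly"
  assumes n: "n = Suc m + Suc k" and \<kappa>: "\<kappa> \<noteq> 0"
    and deg: "degree a \<le> n" "degree c \<le> n" "degree p1 \<le> Suc m" "degree p2 \<le> Suc m"
      "degree q2 \<le> Suc k" "degree P \<le> m" "degree Q \<le> k"
      "degree F \<le> n - 1" "degree G \<le> n - 1"
    and F: "smult (const2 \<kappa>) F = lift p2 * Q - lift q2 * P"
    and FG: "lift p2 * G + lift p1 * F = - (lift c * P)"
    and LF: "[:- X2, Y2:] * F = smult (hom n c) (lift a) - smult (hom n a) (lift c)"
    and nz: "resultant_sub m (Suc m) P (lift p2) \<noteq> 0" "hom n c \<noteq> 0"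
      "resultant_sub (Suc k) (Suc m) (lift q2) (lift p2) \<noteq> 0"
      "resultant_sub n n (lift a) (lift c) \<noteq> 0"
  shows "resultant_sub (n - 1) (n - 1) F G \<doteq> hom n c ^ (n - 1) * resultant_sub m k P Q"
proof -
  define C where "C = hom n c"
  define FGr where "FGr = resultant_sub (n - 1) (n - 1) F G"
  define Fp where "Fp = resultant_sub (n - 1) (Suc m) F (lift p2)"
  define Fc where "Fc = resultant_sub (n - 1) n F (lift c)"
  define FP where "FP = resultant_sub (n - 1) m F P"
  define Pp where "Pp = resultant_sub m (Suc m) P (lift p2)"
  define PQ where "PQ = resultant_sub m k P Q"
  define qp where "qp = resultant_sub (Suc k) (Suc m) (lift q2) (lift p2)"
  define ac where "ac = resultant_sub n n (lift a) (lift c)"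
  have dmul: "degree (f * g) \<le> d" if "degree f + degree g \<le> d" for f g :: "complex poly poly poly" and d
    using degree_mult_le[of f g] that by linarith
  \<comment> \<open>Both sides are Res(F, p2 G) up to sign; \<open>FG\<close> replaces p2 G by -c P
    after a multiple of \<open>F\<close> is dropped.\<close>
  have 1: "FGr * Fp \<doteq> Fc * FP"
  proof -
    have "resultant_sub (n - 1) (n - 1 + Suc m) F (G * lift p2) = FGr * Fp"
      unfolding FGr_def Fp_def by (rule resultant_sub_mult_right) (use deg in auto)
    moreover have "G * lift p2 = - (lift c * P) + (- lift p1) * F"
      using FG by (simp add: algebra_simps eq_neg_iff_add_eq_0)
    moreover have "resultant_sub (n - 1) (n - 1 + Suc m) F (- (lift c * P) + (- lift p1) * F) =
        resultant_sub (n - 1) (n - 1 + Suc m) F (- (lift c * P))"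
      by (rule resultant_sub_add_mult_right) (use deg n in \<open>auto intro!: dmul\<close>)
    moreover have "resultant_sub (n - 1) (n - 1 + Suc m) F (smult (-1) (lift c * P)) =
        (-1) ^ (n - 1) * resultant_sub (n - 1) (n - 1 + Suc m) F (lift c * P)"
      by (rule resultant_sub_smult_right) (use deg n in \<open>auto intro!: dmul\<close>)
    moreover have "resultant_sub (n - 1) (n + m) F (lift c * P) = Fc * FP"
      unfolding Fc_def FP_def by (rule resultant_sub_mult_right) (use deg in auto)
    moreover have "n - 1 + Suc m = n + m" using n by simp
    ultimately show ?thesis by (simp add: eq_const_minus_one_power)
  qed
  have 2: "Fp \<doteq> qp * Pp"
  proof -
    have "const2 \<kappa> ^ Suc m * Fp = resultant_sub (n - 1) (Suc m) (lift p2 * Q - lift q2 * P) (lift p2)"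
      unfolding Fp_def F[symmetric] by (rule resultant_sub_smult_left[symmetric]) (use deg in auto)
    also have "lift p2 * Q - lift q2 * P = - (lift q2 * P) + Q * lift p2" by (simp add: mult.commute)
    also have "resultant_sub (n - 1) (Suc m) (- (lift q2 * P) + Q * lift p2) (lift p2) =
        resultant_sub (n - 1) (Suc m) (- (lift q2 * P)) (lift p2)"
      by (rule resultant_sub_add_mult_left) (use deg n in \<open>auto intro!: dmul\<close>)
    also have "- (lift q2 * P) = smult (-1) (lift q2 * P)" by simp
    also have "resultant_sub (n - 1) (Suc m) (smult (-1) (lift q2 * P)) (lift p2) =
        (-1) ^ Suc m * resultant_sub (n - 1) (Suc m) (lift q2 * P) (lift p2)"
      by (rule resultant_sub_smult_left) (use deg n in \<open>auto intro!: dmul\<close>)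
    also have "resultant_sub (n - 1) (Suc m) (lift q2 * P) (lift p2) = qp * Pp"
      using resultant_sub_mult_left[of "lift q2" "Suc k" P m "lift p2" "Suc m"] deg n
      by (simp add: qp_def Pp_def add.commute)
    finally have "const2 \<kappa> ^ Suc m * Fp \<doteq> qp * Pp"
      by (simp only: eq_const_minus_one_power)
    then show ?thesis
      using eq_const_sym[OF eq_const_const2_mult[of "\<kappa> ^ Suc m" Fp]] \<kappa>
      by (auto simp: const2_power simp del: power_Suc intro: eq_const_trans)
  qed
  have 3: "FP \<doteq> Pp * PQ"
  proof -
    have "const2 \<kappa> ^ m * FP = resultant_sub (n - 1) m (lift p2 * Q - lift q2 * P) P"
      unfolding FP_def F[symmetric] by (rule resultant_sub_smult_left[symmetric]) (use deg in auto)
    also have "lift p2 * Q - lift q2 * P = lift p2 * Q + (- lift q2) * P" by simp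
    also have "resultant_sub (n - 1) m (lift p2 * Q + (- lift q2) * P) P = resultant_sub (n - 1) m (lift p2 * Q) P"
      by (rule resultant_sub_add_mult_left) (use deg n in \<open>auto intro!: dmul\<close>)
    also have "\<dots> = resultant_sub (Suc m) m (lift p2) P * resultant_sub k m Q P"
      using resultant_sub_mult_left[of "lift p2" "Suc m" Q k P m] deg n by simp
    also have "\<dots> \<doteq> Pp * PQ"
      unfolding Pp_def PQ_def by (intro eq_const_mult eq_const_swap)
    finally have "const2 \<kappa> ^ m * FP \<doteq> Pp * PQ" .
    then show ?thesis
      using eq_const_sym[OF eq_const_const2_mult[of "\<kappa> ^ m" FP]] \<kappa>
      by (auto simp: const2_power intro: eq_const_trans)
  qed
  \<comment> \<open>Both sides are Res(L F, c) up to sign. Here Res(L, c) is the value of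
    \<open>c\<close> at the root of L, that is \<open>C\<close>, and by \<open>LF\<close> only the
    term \<open>smult C (lift a)\<close> of L F counts modulo \<open>lift c\<close>.\<close>
  have 4: "C * Fc \<doteq> C ^ n * ac"
  proof -
    have "resultant_sub (1 + (n - 1)) n ([:- X2, Y2:] * F) (lift c) =
        resultant_sub 1 n [:- X2, Y2:] (lift c) * Fc"
      unfolding Fc_def by (rule resultant_sub_mult_left) (use deg in auto)
    moreover have "resultant_sub 1 n [:- X2, Y2:] (lift c) \<doteq> C"
    proof -
      have "resultant_sub 1 n [:- X2, Y2:] (lift c) \<doteq> resultant_sub n 1 (lift c) [:- X2, Y2:]"
        by (rule eq_const_swap)
      also have "\<dots> = (-1) ^ n * C"
        unfolding C_def hom_eq_homog_eval by (rule resultant_sub_linear_right) (use deg in auto)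
      also have "\<dots> \<doteq> C" by (rule eq_const_minus_one_power)
      finally show ?thesis .
    qed
    moreover have "resultant_sub (1 + (n - 1)) n ([:- X2, Y2:] * F) (lift c) = C ^ n * ac"
    proof -
      have "resultant_sub n n (smult C (lift a) + [:- hom n a:] * lift c) (lift c) =
          resultant_sub n n (smult C (lift a)) (lift c)"
        by (rule resultant_sub_add_mult_left) (use deg in \<open>auto intro: order.trans[OF degree_smult_le]\<close>)
      also have "\<dots> = C ^ n * ac"
        unfolding ac_def by (rule resultant_sub_smult_left) (use deg in auto)
      finally show ?thesis using n unfolding LF C_def by simp
    qed
    ultimately show ?thesis
      using eq_const_mult[OF eq_const_sym eq_const_refl, of _ C Fc] by metis
  qed
  \<comment> \<open>Both forms have complex coefficients, so the resultant is a nonzero constant and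
    can be absorbed.\<close>
  have ac: "X * ac \<doteq> X" for X
    using eq_const_const2_mult[of "resultant_sub n n a c" X] nz(4)
    by (simp add: ac_def resultant_sub_lift_lift mult.commute)
  have qp: "X * qp \<doteq> X" for X
    using eq_const_const2_mult[of "resultant_sub (Suc k) (Suc m) q2 p2" X] nz(3)
    by (simp add: qp_def resultant_sub_lift_lift mult.commute)
  have "FGr * (Pp * C) \<doteq> (FGr * (Pp * C)) * qp" by (rule eq_const_sym[OF qp])
  also have "\<dots> = FGr * (qp * Pp) * C" by (simp add: mult_ac)
  also have "\<dots> \<doteq> FGr * Fp * C"
    by (intro eq_const_mult eq_const_sym[OF 2] eq_const_refl)
  also have "\<dots> \<doteq> Fc * FP * C"
    by (intro eq_const_mult 1 eq_const_refl)
  also have "\<dots> = (C * Fc) * FP" by (simp add: mult_ac)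
  also have "\<dots> \<doteq> (C ^ n * ac) * (Pp * PQ)"
    by (intro eq_const_mult 3 4)
  also have "\<dots> = (C ^ n * (Pp * PQ)) * ac" by (simp add: mult_ac)
  also have "\<dots> \<doteq> C ^ n * (Pp * PQ)" by (rule ac)
  also have "\<dots> = (C ^ (n - 1) * PQ) * (Pp * C)"
    using n by (simp add: mult_ac)
  finally have "FGr \<doteq> C ^ (n - 1) * PQ"
    by (rule eq_const_cancel) (use nz in \<open>simp add: Pp_def C_def\<close>)
  then show ?thesis by (simp add: FGr_def C_def PQ_def)
qed

section \<open>Minors of the Sylvester matrix\<close>

lemma pick_delete:
  assumes "i < n" "k < n - 1"
  shows "pick ({..<n} - {i}) k = (if k < i then k else Suc k)"
proof (cases "k < i")
  case True
  then have "{a \<in> {..<n} - {i}. a < k} = {..<k}" using assms by auto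
  then show ?thesis using pick_card_in_set[of k "{..<n} - {i}"] True assms by simp
next
  case False
  then have "{a \<in> {..<n} - {i}. a < Suc k} = {..<Suc k} - {i}" using assms by auto
  moreover have "card ({..<Suc k} - {i}) = k" using False by simp
  ultimately show ?thesis using pick_card_in_set[of "Suc k" "{..<n} - {i}"] False assms by simp
qed

lemma submatrix_delete:
  assumes A: "A \<in> carrier_mat n n" and ij: "i < n" "j < n"
  shows "submatrix A ({..<n} - {i}) ({..<n} - {j}) = mat_delete A i j"
proof -
  have c: "card {a. a < n \<and> a \<in> {..<n} - {b}} = n - 1" if "b < n" for b
  proof -
    have "{a. a < n \<and> a \<in> {..<n} - {b}} = {..<n} - {b}" by auto
    then show ?thesis using that by simp
  qed
  show ?thesis
    using A ij c[OF ij(1)] c[OF ij(2)]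
    by (intro eq_matI) (auto simp: submatrix_def mat_delete_def pick_delete simp del: One_nat_def)
qed

lemma minors_codim_1:
  fixes A :: "'a::comm_ring_1 mat"
  assumes A: "A \<in> carrier_mat n n" and n: "n > 0"
  shows "minors (n - 1) A = {det (mat_delete A i j) | i j. i < n \<and> j < n}"
proof -
  have sub: "I \<subseteq> {..<n} \<and> card I = n - 1 \<longleftrightarrow> (\<exists>i<n. I = {..<n} - {i})" for I
  proof
    assume I: "I \<subseteq> {..<n} \<and> card I = n - 1"
    then have "finite I" by (auto intro: finite_subset)
    then have "card ({..<n} - I) = 1" using n I by (simp add: card_Diff_subset)
    then obtain i where "{..<n} - I = {i}" by (auto simp: card_1_singleton_iff)
    then show "\<exists>i<n. I = {..<n} - {i}" using I by (intro exI[of _ i]) auto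
  qed auto
  have "minors (n - 1) A = {det (submatrix A I J) | I J. (\<exists>i<n. I = {..<n} - {i}) \<and> (\<exists>j<n. J = {..<n} - {j})}"
    using A unfolding sub[symmetric] minors_def by auto
  also have "\<dots> = {det (submatrix A ({..<n} - {i}) ({..<n} - {j})) | i j. i < n \<and> j < n}"
    by blast
  also have "\<dots> = {det (mat_delete A i j) | i j. i < n \<and> j < n}"
    by (intro Collect_cong ex_cong1) (auto simp: submatrix_delete[OF A])
  finally show ?thesis .
qed

lemma X2_neq_0 [simp]: "X2 \<noteq> 0" and Y2_neq_0 [simp]: "Y2 \<noteq> 0"
  by (simp_all add: X2_def Y2_def)

lemma Y2_not_unit: "\<not> Y2 dvd 1"
  by (simp add: Y2_def is_unit_const_poly_iff is_unit_poly_iff)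

lemma coprime_X2_Y2: "coprime X2 Y2"
proof (rule coprimeI)
  fix d assume d: "d dvd X2" "d dvd Y2"
  then have "degree d \<le> degree Y2" by (intro dvd_imp_degree_le) auto
  then obtain e where e: "d = [:e:]" by (auto simp: Y2_def elim: degree_eq_zeroE)
  then have "e dvd coeff X2 1" using d(1) by (simp add: const_poly_dvd_iff)
  then show "is_unit d" by (simp add: e X2_def is_unit_const_poly_iff)
qed

lemma dvd_if_dvd_mult_coprime:
  fixes d z a b :: "'a::semiring_gcd"
  assumes "d dvd z * a" "d dvd z * b" "coprime a b"
  shows "d dvd z"
proof -
  have "d dvd gcd (z * a) (z * b)" using assms(1,2) by (rule gcd_greatest)
  also have "gcd (z * a) (z * b) = normalize (z * gcd a b)" by (rule gcd_mult_left)
  finally show ?thesis using assms(3) by simp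
qed

text \<open>Factor theorem for a linear form whose leading coefficient \<open>Y2\<close> is not a
  unit. Division factors \<open>Y2 ^ m\<close> times \<open>f\<close>; the powers of
  \<open>Y2\<close> are then cancelled one by one, because modulo \<open>Y2\<close> the linear form
  is \<open>- X2\<close>, which is coprime to \<open>Y2\<close>.\<close>

lemma linear_factor_if_homog_eval_eq_0:
  assumes f: "degree f \<le> m" and 0: "homog_eval m f X2 Y2 = 0"
  obtains h where "f = [:- X2, Y2:] * h" "\<And>i. i \<ge> m \<Longrightarrow> coeff h i = 0"
proof -
  let ?L = "[:- X2, Y2:]"
  have *: "\<exists>h. f = ?L * h" if "smult (Y2 ^ k) f = ?L * h" for k h
    using that
  proof (induction k arbitrary: h)
    case (Suc k)
    have "Y2 dvd coeff h i" for i
    proof -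
      have "Y2 dvd coeff (?L * h) i" unfolding Suc.prems[symmetric] by simp
      moreover have "coeff (?L * h) i = - (X2 * coeff h i) + Y2 * coeff (pCons 0 h) i"
        by (simp add: coeff_pCons split: nat.split)
      ultimately have "Y2 dvd X2 * coeff h i" by (metis dvd_add_left_iff dvd_minus_iff dvd_triv_left)
      then show ?thesis using coprime_X2_Y2 by (simp add: coprime_commute coprime_dvd_mult_right_iff)
    qed
    then have "[:Y2:] dvd h" by (simp add: const_poly_dvd_iff)
    then obtain h' where h': "h = [:Y2:] * h'" by (auto elim: dvdE)
    have "smult Y2 (smult (Y2 ^ k) f) = smult Y2 (?L * h')"
      using Suc.prems unfolding h' by (simp add: mult.left_commute)
    then have "smult Y2 (smult (Y2 ^ k) f - ?L * h') = 0" by (simp add: smult_diff_right)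
    then have "smult (Y2 ^ k) f = ?L * h'" by (simp only: smult_eq_0_iff) simp
    then show ?case by (rule Suc.IH)
  qed auto
  obtain h0 where "smult (Y2 ^ m) f = h0 * ?L + [:homog_eval m f X2 Y2:]"
    using homogenised_division[OF f] by metis
  then obtain h where h: "f = ?L * h" using *[of m h0] by (auto simp: 0 mult.commute)
  have "coeff h i = 0" if "i \<ge> m" for i
  proof (cases "h = 0")
    case False
    have "degree f = 1 + degree h" unfolding h using False by (subst degree_mult_eq) auto
    then show ?thesis using f that by (intro coeff_eq_0) auto
  qed simp
  then show ?thesis using h that by blast
qed

text \<open>By the cofactor formula, the minors are the products of the resultant with a coefficient of
  f or g and a monomial X2 ^ (m + k + 1 - j) * Y2 ^ j.\<close>

lemma Gcd_minors_common_linear_factor: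
  fixes f g :: "complex poly poly poly"
  assumes f: "degree f \<le> m" and g: "degree g \<le> k"
    and content: "\<And>x. [:x:] dvd f \<Longrightarrow> [:x:] dvd g \<Longrightarrow> x dvd 1"
  shows "Gcd (minors (m + k + 1) (sylvester_mat_sub (Suc m) (Suc k) ([:- X2, Y2:] * f) ([:- X2, Y2:] * g)))
    \<doteq> resultant_sub m k f g"
proof -
  define S where "S = sylvester_mat_sub (Suc m) (Suc k) ([:- X2, Y2:] * f) ([:- X2, Y2:] * g)"
  define \<rho> where "\<rho> = resultant_sub m k f g"
  define z where "z i = (if i < Suc k then coeff g (Suc k - 1 - i) else - coeff f (Suc m - 1 - (i - Suc k)))" for i
  let ?N = "Suc m + Suc k"
  let ?w = "\<lambda>j. X2 ^ (m + Suc k - j) * Y2 ^ j"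
  have S: "S \<in> carrier_mat ?N ?N" by (auto simp: S_def)
  have minors: "minors (m + k + 1) S = {det (mat_delete S i j) | i j. i < ?N \<and> j < ?N}"
    using minors_codim_1[OF S] by simp
  have cof: "cofactor S i j = (-1) ^ Suc m * \<rho> * z i * ?w j" if "i < ?N" "j < ?N" for i j
    unfolding S_def \<rho>_def z_def
    by (rule cofactor_sylvester_common_linear_factor[OF f g X2_neq_0 that])
  have det: "det (mat_delete S i j) = (-1) ^ (i + j) * cofactor S i j" for i j
    by (simp add: cofactor_def flip: mult.assoc power_add)
  have "\<rho> dvd Gcd (minors (m + k + 1) S)"
  proof (rule Gcd_greatest)
    fix b assume "b \<in> minors (m + k + 1) S"
    then obtain i j where "i < ?N" "j < ?N" "b = det (mat_delete S i j)" unfolding minors by blast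
    then show "\<rho> dvd b" by (simp only: det cof) (simp only: mult_ac dvd_mult dvd_triv_left)
  qed
  moreover have "Gcd (minors (m + k + 1) S) dvd \<rho>"
  proof (cases "\<rho> = 0")
    case False
    \<comment> \<open>The excess of the gcd over the resultant; it has to be shown to be a
      unit.\<close>
    obtain \<gamma> where \<gamma>: "Gcd (minors (m + k + 1) S) = \<rho> * \<gamma>" using calculation by (auto elim: dvdE)
    have zw: "\<gamma> dvd z i * ?w j" if ij: "i < ?N" "j < ?N" for i j
    proof -
      have "\<rho> * \<gamma> dvd det (mat_delete S i j)"
        unfolding \<gamma>[symmetric] minors by (rule Gcd_dvd) (use ij in blast)
      also have "\<dots> dvd (-1) ^ (i + j + Suc m) * det (mat_delete S i j)" by simp
      also have "\<dots> = ((-1) ^ (i + j + Suc m) * (-1) ^ (i + j + Suc m)) * (\<rho> * (z i * ?w j))"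
        unfolding det cof[OF ij] power_add by (simp only: mult_ac)
      also have "\<dots> = \<rho> * (z i * ?w j)"
        by (simp flip: power_mult_distrib)
      finally show ?thesis using False by (simp only: dvd_mult_cancel_left) simp
    qed
    have z: "\<gamma> dvd z i" if i: "i < ?N" for i
    proof (rule dvd_if_dvd_mult_coprime)
      show "\<gamma> dvd z i * X2 ^ (m + Suc k)" using zw[OF i, of 0] by simp
      show "\<gamma> dvd z i * Y2 ^ (m + Suc k)" using zw[OF i, of "m + Suc k"] by simp
      show "coprime (X2 ^ (m + Suc k)) (Y2 ^ (m + Suc k))"
        using coprime_X2_Y2 by (simp only: coprime_power_left_iff coprime_power_right_iff) simp
    qed
    have "\<gamma> dvd coeff g i" for i
    proof (cases "i \<le> k")
      case True
      moreover have "\<gamma> dvd z (k - i)" by (rule z) linarith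
      moreover have "z (k - i) = coeff g i" using True by (auto simp: z_def less_Suc_eq_le)
      ultimately show ?thesis by simp
    qed (use g in \<open>simp add: coeff_eq_0\<close>)
    moreover have "\<gamma> dvd coeff f i" for i
    proof (cases "i \<le> m")
      case True
      moreover have "\<gamma> dvd z (Suc k + (m - i))" by (rule z) linarith
      moreover have "z (Suc k + (m - i)) = - coeff f i" using True by (auto simp: z_def)
      ultimately show ?thesis by simp
    qed (use f in \<open>simp add: coeff_eq_0\<close>)
    ultimately have "\<gamma> dvd 1" by (intro content) (auto simp: const_poly_dvd_iff)
    then have "\<rho> * \<gamma> dvd \<rho> * 1" by (intro mult_dvd_mono) auto
    then show ?thesis unfolding \<gamma> mult_1_right .
  qed simp
  ultimately show ?thesis by (simp add: eq_const_iff_dvd S_def \<rho>_def)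
qed

text \<open>Eliminating \<open>hom n f\<close> from two coefficients of the wedge shows that
  \<open>x\<close> divides \<open>hom n c\<close> times each 2 x 2 determinant of coefficients of
  \<open>c\<close> and \<open>f\<close>. Either \<open>x\<close> divides \<open>hom n c\<close>, and
  then all three forms, or every determinant vanishes and \<open>a\<close>, \<open>b\<close> are
  multiples of \<open>c\<close>.\<close>

lemma dvd_1_if_dvd_wedge:
  assumes deg: "degree a \<le> n" "degree b \<le> n" "degree c \<le> n" and c0: "c \<noteq> 0"
    and gcd: "\<And>y. y dvd hom n a \<Longrightarrow> y dvd hom n b \<Longrightarrow> y dvd hom n c \<Longrightarrow> y dvd 1"
    and nonconst: "\<And>\<alpha> \<beta>. \<not> (a = smult \<alpha> c \<and> b = smult \<beta> c)"
    and ca: "[:x:] dvd smult (hom n a) (lift c) - smult (hom n c) (lift a)"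
    and cb: "[:x:] dvd smult (hom n b) (lift c) - smult (hom n c) (lift b)"
  shows "x dvd 1"
proof -
  let ?A = "hom n a" and ?B = "hom n b" and ?C = "hom n c"
  define i where "i = degree c"
  have ci: "coeff c i \<noteq> 0" using c0 by (simp add: i_def)
  have key: "x dvd const2 (coeff c j * coeff f i - coeff f j * coeff c i) * ?C \<and>
      (x dvd ?C \<longrightarrow> x dvd hom n f)"
    if "[:x:] dvd smult (hom n f) (lift c) - smult ?C (lift f)" for f j
  proof -
    have *: "x dvd hom n f * const2 (coeff c j) - ?C * const2 (coeff f j)" for j
      using that by (auto simp: const_poly_dvd_iff)
    have "x dvd (hom n f * const2 (coeff c j) - ?C * const2 (coeff f j)) * const2 (coeff c i)
        - (hom n f * const2 (coeff c i) - ?C * const2 (coeff f i)) * const2 (coeff c j)"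
      by (intro dvd_diff dvd_mult2 *)
    then have "x dvd const2 (coeff c j * coeff f i - coeff f j * coeff c i) * ?C"
      by (simp add: const2_mult const2_diff algebra_simps)
    moreover have "x dvd hom n f" if "x dvd ?C"
    proof -
      have "x dvd (hom n f * const2 (coeff c i) - ?C * const2 (coeff f i)) + ?C * const2 (coeff f i)"
        using that by (intro dvd_add dvd_mult2 *)
      then have "x dvd hom n f * const2 (coeff c i)" by simp
      then have "x dvd hom n f * const2 (coeff c i) * const2 (1 / coeff c i)" by (rule dvd_mult2)
      then show ?thesis using ci by (simp add: mult.assoc flip: const2_mult)
    qed
    ultimately show ?thesis by blast
  qed
  show ?thesis
  proof (cases "x dvd ?C")
    case True
    then show ?thesis using key[OF ca] key[OF cb] by (intro gcd) auto
  next
    case False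
    have "f = smult (coeff f i / coeff c i) c"
      if "[:x:] dvd smult (hom n f) (lift c) - smult ?C (lift f)" for f
    proof (rule poly_eqI)
      fix j
      let ?d = "coeff c j * coeff f i - coeff f j * coeff c i"
      have "?d = 0"
      proof (rule ccontr)
        assume "?d \<noteq> 0"
        have "x dvd const2 (1 / ?d) * (const2 ?d * ?C)" using key[OF that, of j] by (rule dvd_mult[OF conjunct1])
        then show False using False \<open>?d \<noteq> 0\<close> by (simp flip: mult.assoc const2_mult)
      qed
      then show "coeff f j = coeff (smult (coeff f i / coeff c i) c) j"
        using ci by (simp add: field_simps)
    qed
    then show ?thesis using nonconst ca cb by blast
  qed
qed


section \<open>Birationality, coprimality and the cross product of the two syzygies\<close>

lemma evf_smult: "evf n (smult k a) s v = k * evf n a s v"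
  by (simp add: evf_def sum_distrib_left mult.assoc)

text \<open>For a constant map the parameter x + 1 has the same image as x, for every x, so the
  exceptional set is infinite.\<close>

lemma birational_param_nonconst:
  assumes "birational_param n a b c"
  shows "\<not> (a = smult \<alpha> c \<and> b = smult \<beta> c)"
proof
  assume ab: "a = smult \<alpha> c \<and> b = smult \<beta> c"
  have "\<exists>s v. (s, v) \<noteq> (0, 0) \<and> s \<noteq> x * v \<and>
      parallel3 (evf n a s v, evf n b s v, evf n c s v) (evf n a x 1, evf n b x 1, evf n c x 1)" for x :: complex
    by (intro exI[of _ "x + 1"] exI[of _ 1]) (simp add: ab evf_smult parallel3_def)
  then have "finite (UNIV :: complex set)"
    using assms by (simp add: birational_param_def)
  then show False by (simp add: infinite_UNIV_char_0)
qed

lemma hom_not_unit: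
  assumes "degree a \<le> 1" "coeff a 1 \<noteq> 0"
  shows "\<not> hom 1 a dvd 1"
proof
  assume "hom 1 a dvd 1"
  then have "dehom (hom 1 a) dvd dehom 1" by (metis dehom_mult dvd_def)
  then have "a dvd 1" using assms by (simp add: dehom_hom) (simp add: dehom_def)
  then have "degree a = 0" by (auto simp: is_unit_poly_iff)
  then show False using assms by (simp add: coeff_eq_0)
qed

lemma hom_dvd_if_root:
  assumes a: "degree a \<le> n" and r: "poly a r = 0" and n: "n \<ge> 1"
  shows "hom 1 [:- r, 1:] dvd hom n a"
proof -
  obtain a' where a': "a = [:- r, 1:] * a'" using r by (auto simp: poly_eq_0_iff_dvd elim: dvdE)
  have "degree a' \<le> n - 1"
  proof (cases "a' = 0")
    case False
    have "degree a = 1 + degree a'" unfolding a' using False by (subst degree_mult_eq) auto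
    then show ?thesis using a n by simp
  qed simp
  then have "hom (1 + (n - 1)) a = hom 1 [:- r, 1:] * hom (n - 1) a'"
    unfolding a' by (intro hom_mult) auto
  then show ?thesis using n by simp
qed

lemma Y2_dvd_hom:
  assumes a: "degree a \<le> n" and r: "coeff a n = 0" and n: "n \<ge> 1"
  shows "Y2 dvd hom n a"
proof -
  have "degree a \<le> n - 1"
    using a r n by (metis One_nat_def Suc_pred degree_0 le_Suc_eq leading_coeff_0_iff le0 less_eq_Suc_le)
  then have "hom (n - 1 + 1) a = Y2 ^ 1 * hom (n - 1) a"
    unfolding hom_eq_homog_eval by (intro homog_eval_raise_degree) simp
  then show ?thesis using n by simp
qed

text \<open>Coprimality gives (w1, w2, w3) = g (a, b, c). The factor g is constant because
  \<open>a\<close> attains the formal degree \<open>n\<close>, which bounds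
  \<open>w1\<close>.\<close>

lemma pairwise_const_mult_aux:
  fixes a b c :: "complex poly"
  assumes w: "w1 * b = w2 * a" "w1 * c = w3 * a"
    and deg: "degree w1 \<le> n" and a: "degree a = n" "a \<noteq> 0"
    and cop: "gcd a (gcd b c) = 1" and nz: "\<not> (w1 = 0 \<and> w2 = 0 \<and> w3 = 0)"
  shows "\<exists>k. k \<noteq> 0 \<and> w1 = smult k a \<and> w2 = smult k b \<and> w3 = smult k c"
proof -
  have "a dvd w1 * b" "a dvd w1 * c" by (simp_all add: w)
  then have "a dvd gcd (w1 * a) (gcd (w1 * b) (w1 * c))" by simp
  also have "\<dots> dvd w1 * gcd a (gcd b c)"
    by (simp add: gcd_mult_left)
  finally have "a dvd w1" by (simp add: cop)
  then obtain g where g: "w1 = a * g" by (auto elim: dvdE)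
  have w23: "w2 = b * g" "w3 = c * g" using w a by (auto simp: g)
  have "g \<noteq> 0" using nz g w23 by auto
  then have "degree g = 0" using deg a unfolding g by (subst (asm) degree_mult_eq) auto
  then obtain k where "g = [:k:]" by (auto elim: degree_eq_zeroE)
  then show ?thesis using \<open>g \<noteq> 0\<close> g w23 by (intro exI[of _ k]) auto
qed

text \<open>Without a common zero at infinity, one of the three forms attains the formal degree and
  can serve as pivot.\<close>

lemma pairwise_const_mult:
  fixes a b c :: "complex poly"
  assumes w: "w1 * b = w2 * a" "w1 * c = w3 * a" "w2 * c = w3 * b"
    and deg: "degree w1 \<le> n" "degree w2 \<le> n" "degree w3 \<le> n"
      "degree a \<le> n" "degree b \<le> n" "degree c \<le> n"
    and roots: "\<And>r. \<not> (poly a r = 0 \<and> poly b r = 0 \<and> poly c r = 0)"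
    and inf: "\<not> (coeff a n = 0 \<and> coeff b n = 0 \<and> coeff c n = 0)"
    and nz: "\<not> (w1 = 0 \<and> w2 = 0 \<and> w3 = 0)"
  shows "\<exists>k. k \<noteq> 0 \<and> w1 = smult k a \<and> w2 = smult k b \<and> w3 = smult k c"
proof -
  have g: "gcd a (gcd b c) = 1"
  proof -
    let ?g = "gcd a (gcd b c)"
    have "constant (poly ?g)"
    proof (rule ccontr)
      assume "\<not> constant (poly ?g)"
      then obtain r where "poly ?g r = 0" using fundamental_theorem_of_algebra by blast
      then have "[:- r, 1:] dvd ?g" by (simp add: poly_eq_0_iff_dvd)
      then show False using roots[of r] by (simp add: poly_eq_0_iff_dvd)
    qed
    then have "degree ?g = 0" by (simp add: constant_degree)
    moreover have "?g \<noteq> 0" using inf by auto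
    ultimately have "is_unit ?g" by (simp add: is_unit_iff_degree)
    then show ?thesis by (metis is_unit_gcd_iff)
  qed
  have deg_eq: "degree x = n \<and> x \<noteq> 0" if "coeff x n \<noteq> 0" "degree x \<le> n" for x :: "complex poly"
    using that by (metis coeff_0 le_antisym le_degree)
  consider "coeff a n \<noteq> 0" | "coeff b n \<noteq> 0" | "coeff c n \<noteq> 0" using inf by blast
  then show ?thesis
  proof cases
    case 1
    then show ?thesis
      using pairwise_const_mult_aux[of w1 b w2 a c w3 n] w deg g nz deg_eq[of a] by blast
  next
    case 2
    have "gcd b (gcd a c) = 1" using g by (simp add: gcd.left_commute)
    then show ?thesis
      using pairwise_const_mult_aux[of w2 a w1 b c w3 n] w deg nz deg_eq[of b] 2 by metis
  next
    case 3
    have "gcd c (gcd a b) = 1" using g by (simp add: gcd.commute gcd.left_commute)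
    then show ?thesis
      using pairwise_const_mult_aux[of w3 a w1 c b w2 n] w deg nz deg_eq[of c] 3 by metis
  qed
qed

lemma coeff_mult_formal_lead:
  fixes f g :: "'a::comm_ring_1 poly"
  assumes "degree f \<le> m" "degree g \<le> k"
  shows "coeff (f * g) (m + k) = coeff f m * coeff g k"
proof -
  have *: "homog_eval d h 1 0 = coeff h d" for d and h :: "'a poly"
  proof -
    have "homog_eval d h 1 0 = (\<Sum>i\<le>d. if i = d then coeff h d else 0)"
      unfolding homog_eval_def by (intro sum.cong) (auto simp: power_0_left)
    then show ?thesis by simp
  qed
  show ?thesis using homog_eval_mult[OF assms, of 1 0] by (simp add: *)
qed

text \<open>The nonvanishing conditions of \<open>resultant_quotients\<close> are checked root by
  root, infinity included. By \<open>w\<close>, a common zero of \<open>p2\<close> and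
  \<open>q2\<close>, or of all of \<open>p1\<close>, \<open>p2\<close>, \<open>p3\<close>, would be
  a common zero of \<open>a\<close> and \<open>c\<close>.\<close>

lemma resultant_quotients_coprime:
  fixes P Q F G :: "complex poly poly poly"
  assumes n: "n = Suc m + Suc k" and \<kappa>: "\<kappa> \<noteq> 0"
    and deg: "degree a \<le> n" "degree c \<le> n"
      "degree p1 \<le> Suc m" "degree p2 \<le> Suc m" "degree p3 \<le> Suc m"
      "degree q1 \<le> Suc k" "degree q2 \<le> Suc k" "degree q3 \<le> Suc k"
      "degree P \<le> m" "degree Q \<le> k" "degree F \<le> n - 1" "degree G \<le> n - 1"
    and w: "p2 * q3 - p3 * q2 = smult \<kappa> a" "p3 * q1 - p1 * q3 = smult \<kappa> b" "p1 * q2 - p2 * q1 = smult \<kappa> c"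
    and P: "[:- X2, Y2:] * P = smult (hom n a) (lift p1) + smult B (lift p2) + smult (hom n c) (lift p3)"
    and F: "smult (const2 \<kappa>) F = lift p2 * Q - lift q2 * P"
    and FG: "lift p2 * G + lift p1 * F = - (lift c * P)"
    and LF: "[:- X2, Y2:] * F = smult (hom n c) (lift a) - smult (hom n a) (lift c)"
    and c0: "c \<noteq> 0"
    and roots: "\<And>r. \<not> (poly a r = 0 \<and> poly c r = 0)"
    and inf: "\<not> (coeff a n = 0 \<and> coeff c n = 0)"
  shows "resultant_sub (n - 1) (n - 1) F G \<doteq> hom n c ^ (n - 1) * resultant_sub m k P Q"
proof (rule resultant_quotients[OF n \<kappa> deg(1,2,3,4,7,9-12) F FG LF])
  have wr: "poly p2 r * poly q3 r - poly p3 r * poly q2 r = \<kappa> * poly a r"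
    "poly p1 r * poly q2 r - poly p2 r * poly q1 r = \<kappa> * poly c r" for r
    using w(1,3)[THEN arg_cong, of "\<lambda>p. poly p r"] by simp_all
  have wn: "coeff p2 (Suc m) * coeff q3 (Suc k) - coeff p3 (Suc m) * coeff q2 (Suc k) = \<kappa> * coeff a n"
    "coeff p1 (Suc m) * coeff q2 (Suc k) - coeff p2 (Suc m) * coeff q1 (Suc k) = \<kappa> * coeff c n"
    using w(1,3)[THEN arg_cong, of "\<lambda>p. coeff p n"] deg unfolding n
    by (simp_all only: coeff_diff coeff_mult_formal_lead coeff_smult)
  \<comment> \<open>If \<open>\<alpha>\<close> were nonzero, all zeros of \<open>c\<close> would be
    zeros of \<open>a\<close>; then \<open>c\<close> would have none, even at infinity, despite its
    positive formal degree.\<close>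
  have indep: "\<alpha> = 0 \<and> \<gamma> = 0" if "const2 \<alpha> * hom n a + const2 \<gamma> * hom n c = 0" for \<alpha> \<gamma>
  proof -
    have "hom n (smult \<alpha> a + smult \<gamma> c) = 0" using that by (simp add: hom_add hom_smult)
    moreover have "degree (smult \<alpha> a + smult \<gamma> c) \<le> n"
      using deg by (intro degree_add_le order.trans[OF degree_smult_le])
    ultimately have *: "smult \<alpha> a + smult \<gamma> c = 0" by (simp add: hom_eq_0_iff)
    have const: "\<exists>x. x \<noteq> 0 \<and> f = [:x:]" if "\<And>r. poly f r \<noteq> 0" for f :: "complex poly"
    proof -
      have "degree f = 0" using fundamental_theorem_of_algebra[of f] that by (auto simp: constant_degree)
      then obtain x where "f = [:x:]" by (auto elim: degree_eq_zeroE)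
      then show ?thesis using that by auto
    qed
    have r: "\<alpha> * poly a r + \<gamma> * poly c r = 0" for r
      using arg_cong[OF *, of "\<lambda>p. poly p r"] by simp
    have e: "\<alpha> * coeff a n + \<gamma> * coeff c n = 0"
      using arg_cong[OF *, of "\<lambda>p. coeff p n"] by simp
    have "\<alpha> = 0"
    proof (rule ccontr)
      assume "\<alpha> \<noteq> 0"
      then have "poly c r \<noteq> 0" for r using r[of r] roots[of r] by auto
      then obtain x where "c = [:x:]" using const by blast
      then have "coeff c n = 0" using n by simp
      then show False using e \<open>\<alpha> \<noteq> 0\<close> inf by simp
    qed
    then show ?thesis using * c0 by simp
  qed
  have pr: "\<not> (poly p1 r = 0 \<and> poly p2 r = 0 \<and> poly p3 r = 0)" for r
    using wr[of r] roots[of r] \<kappa> by auto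
  have pn: "\<not> (coeff p1 (Suc m) = 0 \<and> coeff p2 (Suc m) = 0 \<and> coeff p3 (Suc m) = 0)"
    using wn inf \<kappa> by auto
  \<comment> \<open>Otherwise \<open>q2\<close> divides both \<open>a\<close> and \<open>c\<close>,
    but a form of positive formal degree has a zero on the projective line.\<close>
  have p2: "p2 \<noteq> 0"
  proof
    assume p20: "p2 = 0"
    have "poly q2 r \<noteq> 0" for r using wr[of r] roots[of r] \<kappa> p20 by auto
    then have "degree q2 = 0"
      using fundamental_theorem_of_algebra[of q2] by (auto simp: constant_degree)
    then have "coeff q2 (Suc k) = 0" by (simp add: coeff_eq_0)
    then show False using wn inf \<kappa> p20 by simp
  qed
  show "hom n c \<noteq> 0" using c0 deg by (simp add: hom_eq_0_iff)
  show "resultant_sub n n (lift a) (lift c) \<noteq> 0"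
    by (rule resultant_sub_lift_neq_0) (use deg c0 roots inf in \<open>auto simp: poly_lift\<close>)
  show "resultant_sub (Suc k) (Suc m) (lift q2) (lift p2) \<noteq> 0"
  proof (rule resultant_sub_lift_neq_0)
    fix r assume "poly p2 r = 0"
    then show "poly (lift q2) (const2 r) \<noteq> 0"
      using wr[of r] roots[of r] \<kappa> by (auto simp: poly_lift)
  next
    assume "coeff p2 (Suc m) = 0"
    then show "coeff (lift q2) (Suc k) \<noteq> 0" using wn inf \<kappa> by auto
  qed (use deg p2 in auto)
  show "resultant_sub m (Suc m) P (lift p2) \<noteq> 0"
  proof (rule resultant_sub_lift_neq_0)
    fix r assume r: "poly p2 r = 0"
    show "poly P (const2 r) \<noteq> 0"
    proof
      assume "poly P (const2 r) = 0"
      then have "poly ([:- X2, Y2:] * P) (const2 r) = 0" by simp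
      \<comment> \<open>The middle term drops out at a zero of \<open>p2\<close>. Independence of
        \<open>hom n a\<close> and \<open>hom n c\<close> then makes \<open>p1\<close> and
        \<open>p3\<close> vanish there as well.\<close>
      then have "const2 (poly p1 r) * hom n a + const2 (poly p3 r) * hom n c = 0"
        unfolding P by (simp add: poly_lift r mult.commute)
      then show False using indep pr r by blast
    qed
  next
    assume e: "coeff p2 (Suc m) = 0"
    show "coeff P m \<noteq> 0"
    proof
      assume Pm: "coeff P m = 0"
      have "coeff ([:- X2, Y2:] * P) (1 + m) = coeff [:- X2, Y2:] 1 * coeff P m"
        using deg by (intro coeff_mult_formal_lead) auto
      then have "coeff ([:- X2, Y2:] * P) (Suc m) = 0" by (simp only: Pm) simp
      then have "const2 (coeff p1 (Suc m)) * hom n a + const2 (coeff p3 (Suc m)) * hom n c = 0"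
        unfolding P by (simp add: e mult.commute)
      then show False using indep pn e by blast
    qed
  qed (use deg p2 in auto)
qed

section \<open>The resultant of the two quotients\<close>

text \<open>Eliminating B from L P and L Q produces F, eliminating A produces G, with the cross
  product supplying the coefficients. The last relation eliminates Q from these two.\<close>

lemma quotient_relations:
  fixes P Q F G L K :: "'a::idom"
  assumes w: "K * a = p2 * q3 - p3 * q2" "K * b = p3 * q1 - p1 * q3" "K * c = p1 * q2 - p2 * q1"
    and PQ: "L * P = A * p1 + B * p2 + C * p3" "L * Q = A * q1 + B * q2 + C * q3"
    and FG: "L * F = C * a - A * c" "L * G = C * b - B * c"
    and nz: "L \<noteq> 0" "K \<noteq> 0"
  shows "K * F = p2 * Q - q2 * P" "p2 * G + p1 * F = - (c * P)"
proof -
  have "L * (K * F) = K * (L * F)" by (simp only: mult.left_commute)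
  also have "\<dots> = C * (K * a) - A * (K * c)"
    unfolding FG by (simp add: algebra_simps)
  also have "\<dots> = p2 * (L * Q) - q2 * (L * P)"
    unfolding w PQ by (simp add: algebra_simps)
  finally have "L * (K * F) = L * (p2 * Q - q2 * P)" by (simp add: algebra_simps)
  then show 1: "K * F = p2 * Q - q2 * P" using nz by simp
  have "L * (K * G) = K * (L * G)" by (simp only: mult.left_commute)
  also have "\<dots> = C * (K * b) - B * (K * c)"
    unfolding FG by (simp add: algebra_simps)
  also have "\<dots> = q1 * (L * P) - p1 * (L * Q)"
    unfolding w PQ by (simp add: algebra_simps)
  finally have "L * (K * G) = L * (q1 * P - p1 * Q)" by (simp add: algebra_simps)
  then have 2: "K * G = q1 * P - p1 * Q" using nz by simp
  have "K * (p2 * G + p1 * F) = p2 * (K * G) + p1 * (K * F)" by (simp add: algebra_simps)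
  also have "\<dots> = - ((p1 * q2 - p2 * q1) * P)" unfolding 1 2 by (simp add: algebra_simps)
  also have "\<dots> = K * (- (c * P))" unfolding w(3)[symmetric] by simp
  finally show "p2 * G + p1 * F = - (c * P)" using nz by (simp only: mult_cancel_left) simp
qed

text \<open>At each zero of \<open>c\<close>, and at infinity, at most one \<open>t\<close> makes a
  + t b vanish, unless \<open>a\<close> and \<open>b\<close> both vanish there. Where
  \<open>b\<close> alone has value 0, division by zero merely adds the harmless value 0 to
  \<open>?bad\<close>.\<close>

lemma exists_coprime_combination:
  fixes a b c :: "complex poly"
  assumes c0: "c \<noteq> 0"
    and roots: "\<And>r. \<not> (poly a r = 0 \<and> poly b r = 0 \<and> poly c r = 0)"
    and inf: "\<not> (coeff a n = 0 \<and> coeff b n = 0 \<and> coeff c n = 0)"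
  obtains t where "\<And>r. \<not> (poly (a + smult t b) r = 0 \<and> poly c r = 0)"
    "\<not> (coeff (a + smult t b) n = 0 \<and> coeff c n = 0)"
proof -
  let ?bad = "insert (- coeff a n / coeff b n) ((\<lambda>r. - poly a r / poly b r) ` {r. poly c r = 0})"
  have "finite ?bad" using c0 by (simp add: poly_roots_finite)
  then obtain t where t: "t \<notin> ?bad" using ex_new_if_finite[of ?bad] infinite_UNIV_char_0 by blast
  have *: "y = 0 \<and> x = 0" if "x + t * y = 0" "t \<noteq> - x / y" for x y :: complex
  proof -
    have "y = 0"
    proof (rule ccontr)
      assume "y \<noteq> 0"
      moreover have "t * y = - x" using that(1) by (simp add: eq_neg_iff_add_eq_0 add.commute)
      ultimately have "t = - x / y" by (simp add: field_simps)
      then show False using that(2) by simp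
    qed
    then show ?thesis using that(1) by simp
  qed
  show ?thesis
  proof (rule that[of t])
    show "\<not> (poly (a + smult t b) r = 0 \<and> poly c r = 0)" for r
      using *[of "poly a r" "poly b r"] t roots[of r] by auto
    show "\<not> (coeff (a + smult t b) n = 0 \<and> coeff c n = 0)"
      using *[of "coeff a n" "coeff b n"] t inf by auto
  qed
qed

lemma linear_quotient_degree:
  fixes H :: "complex poly poly poly"
  assumes "degree ([:- X2, Y2:] * H) \<le> n"
  shows "degree H \<le> n - 1"
proof (cases "H = 0")
  case False
  then have "degree ([:- X2, Y2:] * H) = 1 + degree H" by (subst degree_mult_eq) auto
  then show ?thesis using assms by simp
qed simp

lemma degree_wedge:
  assumes "degree a \<le> n" "degree c \<le> n"
  shows "degree (smult A (lift a) - smult B (lift c)) \<le> n"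
  using assms by (intro degree_diff_le order.trans[OF degree_smult_le]) auto

section \<open>Vanishing resultants and the case of a constant syzygy\<close>

lemma resultant_sub_0_left:
  fixes g :: "'a::idom poly"
  assumes "degree g \<le> n" "n > 0"
  shows "resultant_sub m n 0 g = 0"
  using resultant_sub_smult_left[of 0 m g n 0] assms by (simp add: zero_power)

lemma resultant_sub_0_right:
  fixes f :: "'a::idom poly"
  assumes "degree f \<le> m" "m > 0"
  shows "resultant_sub m n f 0 = 0"
  using resultant_sub_swap[of m n f 0] resultant_sub_0_left[OF assms] by simp

lemma resultant_sub_eq_0_if_dependent:
  fixes f g :: "'a::idom poly"
  assumes fg: "smult x f + smult y g = 0" and xy: "x \<noteq> 0 \<or> y \<noteq> 0"
    and deg: "degree f \<le> n" "degree g \<le> n" and n: "n > 0"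
  shows "resultant_sub n n f g = 0"
proof (cases "x = 0")
  case True
  then have "g = 0" using fg xy by simp
  then show ?thesis using deg n by (simp add: resultant_sub_0_right)
next
  case False
  have "smult x f = 0 + [:- y:] * g" using fg by (simp add: eq_neg_iff_add_eq_0)
  then have "x ^ n * resultant_sub n n f g = resultant_sub n n (0 + [:- y:] * g) g"
    using resultant_sub_smult_left[OF deg, of x] by simp
  also have "\<dots> = resultant_sub n n 0 g" by (rule resultant_sub_add_mult_left) (use deg in auto)
  also have "\<dots> = 0" using deg n by (rule_tac resultant_sub_0_left)
  finally show ?thesis using False by simp
qed

text \<open>The bound excludes \<open>n = 1\<close>, where the only minor is the empty determinant
  1.\<close>

lemma Gcd_minors_0:
  assumes "n \<ge> 2"
  shows "Gcd (minors (n - 1) (0\<^sub>m n n :: complex poly poly mat)) = 0"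
proof -
  have "det (mat_delete (0\<^sub>m n n) i j) = (0 :: complex poly poly)" if "i < n" "j < n" for i j
  proof -
    have "det (mat_delete (0\<^sub>m n n) i j) = (\<Prod>k<n - 1. mat_delete (0\<^sub>m n n) i j $$ (k, k) :: complex poly poly)"
      by (rule det_upper_triangular_prod) (auto simp: mat_delete_def)
    also have "\<dots> = 0" using assms by (intro prod_zero bexI[of _ 0]) (auto simp: mat_delete_def)
    finally show ?thesis .
  qed
  then have "minors (n - 1) (0\<^sub>m n n :: complex poly poly mat) \<subseteq> {0}"
    using assms by (subst minors_codim_1) auto
  then show ?thesis by (simp add: Gcd_0_iff)
qed

text \<open>A constant syzygy means that the curve lies on a line. The same relation makes
  \<open>HF\<close> and \<open>HG\<close> linearly dependent and p_phi zero.\<close>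

lemma resultant_eq_Gcd_minors_degenerate:
  assumes n: "n \<ge> 2"
    and deg: "degree a \<le> n" "degree b \<le> n" "degree c \<le> n" "degree p1 \<le> 0" "degree p2 \<le> 0" "degree p3 \<le> 0"
    and syz: "p1 * a + p2 * b + p3 * c = 0" and nz: "\<not> (p1 = 0 \<and> p2 = 0 \<and> p3 = 0)" and c0: "c \<noteq> 0"
    and LF: "smult (hom n c) (lift a) - smult (hom n a) (lift c) = [:- X2, Y2:] * HF"
    and LG: "smult (hom n c) (lift b) - smult (hom n b) (lift c) = [:- X2, Y2:] * HG"
  shows "resultant_sub (n - 1) (n - 1) HF HG = 0"
    and "syz_phi n a b c (p1, p2, p3) = 0"
proof -
  obtain x y z where p: "p1 = [:x:]" "p2 = [:y:]" "p3 = [:z:]"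
    using deg by (metis degree_eq_zeroE le_zero_eq)
  have s: "smult x a + smult y b + smult z c = 0" using syz by (simp add: p)
  have h: "const2 x * hom n a + const2 y * hom n b + const2 z * hom n c = 0"
    using arg_cong[OF s, of "hom n"] by (simp add: hom_add hom_smult)
  have l: "smult (const2 x) (lift a) + smult (const2 y) (lift b) + smult (const2 z) (lift c) = 0"
    using arg_cong[OF s, of lift] by (simp add: lift_add lift_smult)
  show "syz_phi n a b c (p1, p2, p3) = 0"
    using h by (simp add: syz_phi_def p lift_pCons mult.commute)
  have "[:- X2, Y2:] * (smult (const2 x) HF + smult (const2 y) HG) =
      smult (const2 x) ([:- X2, Y2:] * HF) + smult (const2 y) ([:- X2, Y2:] * HG)"
    by (simp only: distrib_left mult_smult_right)
  also have "\<dots> = smult (hom n c) (smult (const2 x) (lift a) + smult (const2 y) (lift b) + smult (const2 z) (lift c))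
     - smult (const2 x * hom n a + const2 y * hom n b + const2 z * hom n c) (lift c)"
    unfolding LF[symmetric] LG[symmetric]
    by (simp add: smult_add_right smult_diff_right smult_add_left mult.commute)
  also have "\<dots> = 0" by (simp only: h l) simp
  finally have dep: "smult (const2 x) HF + smult (const2 y) HG = 0" by (simp only: mult_eq_0_iff) simp
  have "x \<noteq> 0 \<or> y \<noteq> 0" using s nz c0 p by auto
  moreover have "degree HF \<le> n - 1" "degree HG \<le> n - 1"
    using degree_wedge[of a n c] degree_wedge[of b n c] deg LF LG
    by (metis linear_quotient_degree)+
  ultimately show "resultant_sub (n - 1) (n - 1) HF HG = 0"
    using dep n by (intro resultant_sub_eq_0_if_dependent[of "const2 x" _ "const2 y"]) auto
qed

lemma resultant_eq_Gcd_minors: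
  assumes n: "n = Suc m + Suc k"
    and deg: "degree a \<le> n" "degree b \<le> n" "degree c \<le> n"
      "degree p1 \<le> Suc m" "degree p2 \<le> Suc m" "degree p3 \<le> Suc m"
      "degree q1 \<le> Suc k" "degree q2 \<le> Suc k" "degree q3 \<le> Suc k"
    and gcd: "\<And>y. y dvd hom n a \<Longrightarrow> y dvd hom n b \<Longrightarrow> y dvd hom n c \<Longrightarrow> y dvd 1"
    and nonconst: "\<And>\<alpha> \<beta>. \<not> (a = smult \<alpha> c \<and> b = smult \<beta> c)"
    and c0: "c \<noteq> 0"
    and p: "hom (Suc m) p1 * hom n a + hom (Suc m) p2 * hom n b + hom (Suc m) p3 * hom n c = 0"
    and q: "hom (Suc k) q1 * hom n a + hom (Suc k) q2 * hom n b + hom (Suc k) q3 * hom n c = 0"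
    and gen: "\<And>h1 h2 h3. h1 * a + h2 * b + h3 * c = 0 \<Longrightarrow>
      \<exists>f g. h1 = f * p1 + g * q1 \<and> h2 = f * p2 + g * q2 \<and> h3 = f * p3 + g * q3"
    and indep: "p2 * q3 \<noteq> p3 * q2 \<or> p3 * q1 \<noteq> p1 * q3 \<or> p1 * q2 \<noteq> p2 * q1"
    and LF: "smult (hom n c) (lift a) - smult (hom n a) (lift c) = [:- X2, Y2:] * HF"
    and LG: "smult (hom n c) (lift b) - smult (hom n b) (lift c) = [:- X2, Y2:] * HG"
  shows "resultant_sub (n - 1) (n - 1) HF HG \<doteq> hom n c ^ (n - 1) *
    Gcd (minors (n - 1) (sylvester_mat_sub (Suc m) (Suc k)
      (syz_phi n a b c (p1, p2, p3)) (syz_phi n a b c (q1, q2, q3))))"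
proof -
  let ?L = "[:- X2, Y2:]"
  have n1: "n \<ge> 1" using n by simp
  have roots: "\<not> (poly a r = 0 \<and> poly b r = 0 \<and> poly c r = 0)" for r
    using gcd[of "hom 1 [:- r, 1:]"] hom_dvd_if_root[OF _ _ n1] deg hom_not_unit[of "[:- r, 1:]"] by auto
  have inf: "\<not> (coeff a n = 0 \<and> coeff b n = 0 \<and> coeff c n = 0)"
    using gcd[of Y2] Y2_dvd_hom[OF _ _ n1] deg Y2_not_unit by auto
  have pu: "p1 * a + p2 * b + p3 * c = 0"
    using arg_cong[OF p, of dehom] deg by (simp add: dehom_add dehom_mult dehom_hom)
  have qu: "q1 * a + q2 * b + q3 * c = 0"
    using arg_cong[OF q, of dehom] deg by (simp add: dehom_add dehom_mult dehom_hom)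
  have dm: "degree (f * g) \<le> n" "degree (g * f) \<le> n" if "degree f \<le> Suc m" "degree g \<le> Suc k" for f g :: "complex poly"
    using degree_mult_le[of f g] degree_mult_le[of g f] that n by linarith+
  \<comment> \<open>Both (a, b, c) and the cross product are orthogonal to the independent triples p
    and q, hence proportional.\<close>
  have "\<exists>\<kappa>. \<kappa> \<noteq> 0 \<and> p2 * q3 - p3 * q2 = smult \<kappa> a \<and> p3 * q1 - p1 * q3 = smult \<kappa> b \<and> p1 * q2 - p2 * q1 = smult \<kappa> c"
  proof (rule pairwise_const_mult[OF _ _ _ _ _ _ deg(1-3) roots inf])
    have "(p2 * q3 - p3 * q2) * b - (p3 * q1 - p1 * q3) * a
        = q3 * (p1 * a + p2 * b + p3 * c) - p3 * (q1 * a + q2 * b + q3 * c)"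
      by (simp add: algebra_simps)
    then show "(p2 * q3 - p3 * q2) * b = (p3 * q1 - p1 * q3) * a" by (simp add: pu qu)
    have "(p2 * q3 - p3 * q2) * c - (p1 * q2 - p2 * q1) * a
        = p2 * (q1 * a + q2 * b + q3 * c) - q2 * (p1 * a + p2 * b + p3 * c)"
      by (simp add: algebra_simps)
    then show "(p2 * q3 - p3 * q2) * c = (p1 * q2 - p2 * q1) * a" by (simp add: pu qu)
    have "(p3 * q1 - p1 * q3) * c - (p1 * q2 - p2 * q1) * b
        = q1 * (p1 * a + p2 * b + p3 * c) - p1 * (q1 * a + q2 * b + q3 * c)"
      by (simp add: algebra_simps)
    then show "(p3 * q1 - p1 * q3) * c = (p1 * q2 - p2 * q1) * b" by (simp add: pu qu)
    show "degree (p2 * q3 - p3 * q2) \<le> n" "degree (p3 * q1 - p1 * q3) \<le> n" "degree (p1 * q2 - p2 * q1) \<le> n"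
      by (intro degree_diff_le dm(1) deg)+
  qed (use indep in auto)
  then obtain \<kappa> where \<kappa>: "\<kappa> \<noteq> 0" and w: "p2 * q3 - p3 * q2 = smult \<kappa> a"
    "p3 * q1 - p1 * q3 = smult \<kappa> b" "p1 * q2 - p2 * q1 = smult \<kappa> c" by blast
  define P0 where "P0 = syz_phi n a b c (p1, p2, p3)"
  define Q0 where "Q0 = syz_phi n a b c (q1, q2, q3)"
  note PQ0 = P0_def Q0_def syz_phi_def
  have dP0: "degree P0 \<le> Suc m" and dQ0: "degree Q0 \<le> Suc k"
    using deg unfolding PQ0 prod.case by (intro degree_add_le order.trans[OF degree_smult_le]; simp)+
  have "homog_eval (Suc m) P0 X2 Y2 = 0"
    using p by (simp add: PQ0 homog_eval_add homog_eval_smult hom_eq_homog_eval mult.commute)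
  then obtain P where P: "P0 = ?L * P" "\<And>i. i \<ge> Suc m \<Longrightarrow> coeff P i = 0"
    using linear_factor_if_homog_eval_eq_0[OF dP0] by blast
  have "homog_eval (Suc k) Q0 X2 Y2 = 0"
    using q by (simp add: PQ0 homog_eval_add homog_eval_smult hom_eq_homog_eval mult.commute)
  then obtain Q where Q: "Q0 = ?L * Q" "\<And>i. i \<ge> Suc k \<Longrightarrow> coeff Q i = 0"
    using linear_factor_if_homog_eval_eq_0[OF dQ0] by blast
  have dP: "degree P \<le> m" using P(2) by (intro degree_le) auto
  have dQ: "degree Q \<le> k" using Q(2) by (intro degree_le) auto
  \<comment> \<open>The triples (c, 0, -a) and (0, c, -b) are syzygies, thus combinations of p and
    q; so a common content of \<open>P\<close> and \<open>Q\<close> divides both wedges.\<close>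
  have content: "x dvd 1" if x: "[:x:] dvd P" "[:x:] dvd Q" for x
  proof (rule dvd_1_if_dvd_wedge[OF deg(1-3) c0 gcd nonconst])
    have comb: "[:x:] dvd smult (hom n a) (lift h1) + smult (hom n b) (lift h2) + smult (hom n c) (lift h3)"
      if hs: "h1 * a + h2 * b + h3 * c = 0" for h1 h2 h3
    proof -
      obtain f g where h: "h1 = f * p1 + g * q1" "h2 = f * p2 + g * q2" "h3 = f * p3 + g * q3"
        using gen[OF hs] by blast
      have "smult (hom n a) (lift h1) + smult (hom n b) (lift h2) + smult (hom n c) (lift h3) =
          lift f * P0 + lift g * Q0"
        by (simp add: PQ0 h lift_add lift_mult algebra_simps smult_add_right)
      then show ?thesis using x by (simp add: P Q dvd_add dvd_mult del: mult_pCons_left)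
    qed
    show "[:x:] dvd smult (hom n a) (lift c) - smult (hom n c) (lift a)"
      using comb[of c 0 "- a"] lift_diff[of 0 a] by (simp add: mult.commute)
    show "[:x:] dvd smult (hom n b) (lift c) - smult (hom n c) (lift b)"
      using comb[of 0 c "- b"] lift_diff[of 0 b] by (simp add: mult.commute)
  qed
  have minors: "Gcd (minors (n - 1) (sylvester_mat_sub (Suc m) (Suc k) P0 Q0)) \<doteq> resultant_sub m k P Q"
    unfolding P(1) Q(1) using Gcd_minors_common_linear_factor[OF dP dQ content] n by simp
  have dF: "degree HF \<le> n - 1" and dG: "degree HG \<le> n - 1"
    using degree_wedge[of a n c] degree_wedge[of b n c] deg LF LG
    by (metis linear_quotient_degree)+
  obtain t where t: "\<And>r. \<not> (poly (a + smult t b) r = 0 \<and> poly c r = 0)"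
    "\<not> (coeff (a + smult t b) n = 0 \<and> coeff c n = 0)"
    using exists_coprime_combination[OF c0 roots inf] by metis
  define a' where "a' = a + smult t b"
  \<comment> \<open>Dual to the change of \<open>a\<close>: p1 a' + p2' b + p3 c equals p1 a + p2 b
    + p3 c, so \<open>P\<close> and \<open>Q\<close> stay the same and only \<open>HF\<close>
    changes, to \<open>F\<close>.\<close>
  define p2' where "p2' = p2 - smult t p1"
  define q2' where "q2' = q2 - smult t q1"
  define F where "F = HF + [:const2 t:] * HG"
  have la: "lift a' = lift a + smult (const2 t) (lift b)"
    by (simp add: a'_def lift_add lift_smult)
  have ha: "hom n a' = hom n a + const2 t * hom n b"
    by (simp add: a'_def hom_add hom_smult)
  have w': "p2' * q3 - p3 * q2' = smult \<kappa> a'" "p3 * q1 - p1 * q3 = smult \<kappa> b" "p1 * q2' - p2' * q1 = smult \<kappa> c"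
    using w by (simp_all add: p2'_def q2'_def a'_def algebra_simps smult_add_right flip: smult_diff_right)
  have lw: "[:const2 \<kappa>:] * lift a' = lift p2' * lift q3 - lift p3 * lift q2'"
    "[:const2 \<kappa>:] * lift b = lift p3 * lift q1 - lift p1 * lift q3"
    "[:const2 \<kappa>:] * lift c = lift p1 * lift q2' - lift p2' * lift q1"
    using w'[THEN arg_cong, of lift] by (simp_all add: lift_diff lift_mult lift_smult)
  have P': "?L * P = [:hom n a':] * lift p1 + [:hom n b:] * lift p2' + [:hom n c:] * lift p3"
    unfolding P(1)[symmetric] PQ0 prod.case
    by (simp add: ha p2'_def lift_diff lift_smult smult_diff_right smult_add_left mult.commute)
  have Q': "?L * Q = [:hom n a':] * lift q1 + [:hom n b:] * lift q2' + [:hom n c:] * lift q3"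
    unfolding Q(1)[symmetric] PQ0 prod.case
    by (simp add: ha q2'_def lift_diff lift_smult smult_diff_right smult_add_left mult.commute)
  have F': "?L * F = [:hom n c:] * lift a' - [:hom n a':] * lift c"
  proof -
    have "?L * F = ?L * HF + [:const2 t:] * (?L * HG)"
      unfolding F_def by (simp only: distrib_left mult.left_commute)
    then show ?thesis unfolding LF[symmetric] LG[symmetric]
      by (simp add: la ha smult_diff_right smult_add_left smult_add_right mult.commute)
  qed
  have G': "?L * HG = [:hom n c:] * lift b - [:hom n b:] * lift c"
    unfolding LG[symmetric] by simp
  have LK: "?L \<noteq> 0" "[:const2 \<kappa>:] \<noteq> 0" using \<kappa> by simp_all
  note rel = quotient_relations[OF lw P' Q' F' G' LK]
  have dF': "degree F \<le> n - 1"
    unfolding F_def using dF dG by (auto intro!: degree_add_le order.trans[OF degree_smult_le])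
  have "resultant_sub (n - 1) (n - 1) HF HG = resultant_sub (n - 1) (n - 1) F HG"
    unfolding F_def by (rule resultant_sub_add_mult_left[symmetric]) (use dF dG in auto)
  also have "\<dots> \<doteq> hom n c ^ (n - 1) * resultant_sub m k P Q"
  proof (rule resultant_quotients_coprime[where a = a' and b = b and ?p2.0 = p2' and ?q2.0 = q2' and B = "hom n b",
        OF n \<kappa> _ deg(3,4) _ deg(6,7) _ deg(9) dP dQ dF' dG w' _ _ rel(2) _ c0 t[folded a'_def]])
    show "degree a' \<le> n" "degree p2' \<le> Suc m" "degree q2' \<le> Suc k"
      unfolding a'_def p2'_def q2'_def using deg
      by (auto intro!: degree_add_le degree_diff_le order.trans[OF degree_smult_le])
    show "?L * P = smult (hom n a') (lift p1) + smult (hom n b) (lift p2') + smult (hom n c) (lift p3)"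
      using P' by simp
    show "smult (const2 \<kappa>) F = lift p2' * Q - lift q2' * P"
      using rel(1) by simp
    show "?L * F = smult (hom n c) (lift a') - smult (hom n a') (lift c)"
      using F' by simp
  qed
  also have "\<dots> \<doteq> hom n c ^ (n - 1) * Gcd (minors (n - 1) (sylvester_mat_sub (Suc m) (Suc k) P0 Q0))"
    by (intro eq_const_mult eq_const_refl eq_const_sym[OF minors])
  finally show ?thesis by (simp only: P0_def Q0_def)
qed

theorem theorem6p3:
  fixes n \<mu> :: nat and a b c :: "complex poly"
    and p q :: "complex poly \<times> complex poly \<times> complex poly"
    and d :: "nat \<Rightarrow> complex poly poly"
    and HF HG :: "complex poly poly poly"
  assumes "n \<ge> 3"
    and "degree a \<le> n" "degree b \<le> n" "degree c \<le> n"
    and "gcd (hom n a) (gcd (hom n b) (hom n c)) = 1"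
    and "birational_param n a b c"
    and "mu_basis n a b c \<mu> p q"
    and "singular_factors n a b c \<mu> p q d"
    and "smult (hom n c) (lift a) - smult (hom n a) (lift c) = [:- X2, Y2:] * HF"
    and "smult (hom n c) (lift b) - smult (hom n b) (lift c) = [:- X2, Y2:] * HG"
  shows "\<exists>k::complex. k \<noteq> 0 \<and>
    det (sylvester_mat_sub (n - 1) (n - 1) HF HG) =
      const2 k * hom n c ^ (n - 1) * (\<Prod>j\<in>{2..n}. d j ^ (j - 1))"
proof -
  note n = assms(1) and deg = assms(2-4) and LF = assms(9) and LG = assms(10)
  obtain p1 p2 p3 q1 q2 q3 where pq: "p = (p1, p2, p3)" "q = (q1, q2, q3)"
    by (metis prod_cases3)
  define \<nu> where "\<nu> = n - \<mu>"
  have mb: "\<mu> \<le> \<nu>" "degree p1 \<le> \<mu>" "degree p2 \<le> \<mu>" "degree p3 \<le> \<mu>"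
    "degree q1 \<le> \<nu>" "degree q2 \<le> \<nu>" "degree q3 \<le> \<nu>"
    "hom \<mu> p1 * hom n a + hom \<mu> p2 * hom n b + hom \<mu> p3 * hom n c = 0"
    "hom \<nu> q1 * hom n a + hom \<nu> q2 * hom n b + hom \<nu> q3 * hom n c = 0"
    and gen: "\<And>h1 h2 h3. h1 * hom n a + h2 * hom n b + h3 * hom n c = 0 \<Longrightarrow>
      \<exists>f g. h1 = f * hom \<mu> p1 + g * hom \<nu> q1 \<and> h2 = f * hom \<mu> p2 + g * hom \<nu> q2 \<and> h3 = f * hom \<mu> p3 + g * hom \<nu> q3"
    and free: "\<And>f g. f * hom \<mu> p1 + g * hom \<nu> q1 = 0 \<Longrightarrow> f * hom \<mu> p2 + g * hom \<nu> q2 = 0 \<Longrightarrow>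
      f * hom \<mu> p3 + g * hom \<nu> q3 = 0 \<Longrightarrow> f = 0 \<and> g = 0"
    using assms(7) unfolding mu_basis_def pq \<nu>_def[symmetric] prod.case by blast+
  define M where "M = minors (n - 1) (sylvester_mat_sub \<mu> \<nu> (syz_phi n a b c p) (syz_phi n a b c q))"
  have "resultant_sub (n - 1) (n - 1) HF HG \<doteq> hom n c ^ (n - 1) * Gcd M"
  proof (cases "c = 0")
    case True
    then have "[:- X2, Y2:] * HF = 0" unfolding LF[symmetric] by simp
    then have "HF = 0" by (simp only: mult_eq_0_iff) simp
    moreover have "degree HG \<le> n - 1"
      using degree_wedge[of b n c] deg LG by (metis linear_quotient_degree)
    ultimately have "resultant_sub (n - 1) (n - 1) HF HG = 0"
      using n by (simp add: resultant_sub_0_left)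
    then show ?thesis using True n by (simp add: power_0_left)
  next
    case c0: False
    show ?thesis
    proof (cases "\<mu> = 0")
      case True
      have syz: "p1 * a + p2 * b + p3 * c = 0"
        using arg_cong[OF mb(8), of dehom] deg mb(2-4) by (simp add: dehom_add dehom_mult dehom_hom)
      have nz: "\<not> (p1 = 0 \<and> p2 = 0 \<and> p3 = 0)" using free[of 1 0] by auto
      note dg = resultant_eq_Gcd_minors_degenerate[OF _ deg mb(2-4)[unfolded True] syz nz c0 LF LG]
      have "Gcd M = 0"
        using n True dg(2) by (simp add: M_def pq \<nu>_def Gcd_minors_0 flip: One_nat_def)
      then show ?thesis unfolding \<open>Gcd M = 0\<close> using n dg(1) by simp
    next
      case False
      define m where "m = \<mu> - 1"
      define k where "k = \<nu> - 1"
      have \<mu>: "\<mu> = Suc m" and \<nu>: "\<nu> = Suc k" using False mb(1) by (auto simp: m_def k_def)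
      have nmk: "n = Suc m + Suc k" using \<mu> \<nu> \<nu>_def by simp
      have gcd: "y dvd 1" if "y dvd hom n a" "y dvd hom n b" "y dvd hom n c" for y
        using that by (metis assms(5) gcd_greatest)
      have genu: "\<exists>f g. h1 = f * p1 + g * q1 \<and> h2 = f * p2 + g * q2 \<and> h3 = f * p3 + g * q3"
        if "h1 * a + h2 * b + h3 * c = 0" for h1 h2 h3
      proof -
        \<comment> \<open>A common formal degree turns an arbitrary univariate syzygy into a
          homogeneous one, to which \<open>gen\<close> applies.\<close>
        define e where "e = max (degree h1) (max (degree h2) (degree h3))"
        have e: "degree h1 \<le> e" "degree h2 \<le> e" "degree h3 \<le> e" by (auto simp: e_def)
        have "hom (e + n) (h1 * a + h2 * b + h3 * c) = 0" by (simp add: that)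
        then have "hom e h1 * hom n a + hom e h2 * hom n b + hom e h3 * hom n c = 0"
          using e deg by (simp add: hom_add hom_mult)
        then obtain f g where "hom e h1 = f * hom \<mu> p1 + g * hom \<nu> q1"
          "hom e h2 = f * hom \<mu> p2 + g * hom \<nu> q2" "hom e h3 = f * hom \<mu> p3 + g * hom \<nu> q3"
          using gen by blast
        from this[THEN arg_cong, of dehom] show ?thesis
          using e mb(2-7) by (auto simp: dehom_add dehom_mult dehom_hom)
      qed
      have indep: "p2 * q3 \<noteq> p3 * q2 \<or> p3 * q1 \<noteq> p1 * q3 \<or> p1 * q2 \<noteq> p2 * q1"
      proof (rule ccontr)
        assume "\<not> ?thesis"
        then have w: "p2 * q3 = p3 * q2" "p3 * q1 = p1 * q3" "p1 * q2 = p2 * q1" by auto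
        have hm: "hom \<nu> y * hom \<mu> x = hom \<mu> x' * hom \<nu> y'"
          if "x * y = x' * y'" "degree x \<le> \<mu>" "degree y \<le> \<nu>" "degree x' \<le> \<mu>" "degree y' \<le> \<nu>" for x y x' y'
          using that hom_mult[of x \<mu> y \<nu>] hom_mult[of x' \<mu> y' \<nu>] by (simp add: mult.commute)
        \<comment> \<open>Freeness is applied to the relation y p - x q = 0; with x, y the j-th
          entries of p and q this makes both entries vanish.\<close>
        have 0: "hom \<nu> y = 0 \<and> - hom \<mu> x = 0"
          if "degree x \<le> \<mu>" "degree y \<le> \<nu>" "p1 * y = x * q1" "p2 * y = x * q2" "p3 * y = x * q3" for x y
          using that hm[of p1 y x q1] hm[of p2 y x q2] hm[of p3 y x q3] mb(2-7) by (intro free) auto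
        have "hom \<mu> p1 = 0" "hom \<nu> q1 = 0" "hom \<mu> p2 = 0" "hom \<nu> q2 = 0" "hom \<mu> p3 = 0" "hom \<nu> q3 = 0"
          using 0[of p1 q1] 0[of p2 q2] 0[of p3 q3] w mb(2-7) by auto
        then show False using free[of 1 1] by simp
      qed
      show ?thesis
        unfolding M_def pq \<mu> \<nu>
        by (rule resultant_eq_Gcd_minors[OF nmk deg mb(2-7)[unfolded \<mu> \<nu>] gcd
              birational_param_nonconst[OF assms(6)] c0 mb(8,9)[unfolded \<mu> \<nu>] genu indep LF LG])
    qed
  qed
  also have "\<dots> \<doteq> hom n c ^ (n - 1) * (\<Prod>j\<in>{2..n}. d j ^ (j - 1))"
  proof (intro eq_const_mult eq_const_refl eq_const_sym[of _ "Gcd M"])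
    \<comment> \<open>For i = 2 the minors have size n + 1 - 2 = n - 1, and the exponent j - 2 + 1
      is j - 1 since j is at least 2.\<close>
    have "2 \<in> {1..n}" using n by simp
    then obtain x where "x \<noteq> 0" "(\<Prod>j\<in>{2..n}. d j ^ (j - 2 + 1)) = const2 x * Gcd (minors (n + 1 - 2)
        (sylvester_mat_sub \<mu> (n - \<mu>) (syz_phi n a b c p) (syz_phi n a b c q)))"
      using assms(8) unfolding singular_factors_def by blast
    moreover have "(\<Prod>j\<in>{2..n}. d j ^ (j - 2 + 1)) = (\<Prod>j\<in>{2..n}. d j ^ (j - 1))"
      by (intro prod.cong refl arg_cong[of _ _ "power _"]) auto
    moreover have "n + 1 - 2 = n - 1" by simp
    ultimately show "(\<Prod>j\<in>{2..n}. d j ^ (j - 1)) \<doteq> Gcd M"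
      unfolding eq_const_def M_def \<nu>_def by metis
  qed
  finally show ?thesis
    by (simp add: eq_const_def resultant_sub_def mult.assoc)
qed

end
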